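(* Let $G=(X\,\dot\cup\,Y,E)$ be a finite bipartite graph, let $m:=|E|$ and $\underline{n}:=\min(|X|,|Y|)$. Then there exist \emph{unique} partitions $X=X_S\,\dot\cup\,X_L$ and $Y=Y_S\,\dot\cup\,Y_L$ satisfying the following three conditions: (a) there are no edges of $G$ between $X_S$ and $Y_L$; (b) the induced subgraph $G[X_S,Y_S]$ is $Y$-path-saturated; (c) the induced subgraph $G[X_L,Y_L]$ is $X$-saturated, i.e. it admits a matching saturating every vertex of $X_L$. These partitions can be computed in $O(m\sqrt{\underline{n}})$ time. Moreover: (d) $G[X_L,Y_L]$ admits a matching saturating $X_L$, and every such matching is an envy-free matching in $G$; (e) every envy-free matching in $G$ is contained in $G[X_L,Y_L]$.
   Context: For a matching $M\subseteq E$, $X_M$ and $Y_M$ denote the vertices of $X$ and $Y$, respectively, covered by $M$. A matching $M$ is \emph{envy-free} (with respect to $X$) if no vertex of $X\setminus X_M$ is adjacent in $G$ to any vertex of $Y_M$ (the empty matching is vacuously envy-free). $G[X',Y']$ denotes the subgraph induced on $X'\,\dot\cup\,Y'$. A bipartite graph $H=(A\,\dot\cup\,B,F)$ (with $A$ playing the role of $X$ and $B$ of $Y$) is \emph{$Y$-path-saturated} if for some integer $k\ge 1$ there exist partitions $A=A_0\,\dot\cup\cdots\dot\cup\,A_k$ and $B=B_1\,\dot\cup\cdots\dot\cup\,B_k$ (parts may be empty) such that for every $i\ge 1$: there is a perfect matching in $H$ between $A_i$ and $B_i$, and every vertex of $B_i$ is adjacent to some vertex of $A_{i-1}$. (In particular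 the empty graph is $Y$-path-saturated.) *)

theory Defs
  imports Complex_Main "HOL-Library.Disjoint_Sets"
begin

section \<open>Bipartite graphs and matchings\<close>

text \<open>
  A bipartite graph is given by its two sides \<open>X\<close>, \<open>Y\<close> and its edges, written as pairs
  \<open>(x, y)\<close> with \<open>x \<in> X\<close> and \<open>y \<in> Y\<close>. The sides may live in different types; the
  union of the sides is thus disjoint by construction.
\<close>

definition bipartite_graph :: "'a set \<Rightarrow> 'b set \<Rightarrow> ('a \<times> 'b) set \<Rightarrow> bool" where
  "bipartite_graph X Y E \<longleftrightarrow> finite X \<and> finite Y \<and> E \<subseteq> X \<times> Y"

definition induced :: "('a \<times> 'b) set \<Rightarrow> 'a set \<Rightarrow> 'b set \<Rightarrow> ('a \<times> 'b) set" where
  "induced E X' Y' = E \<inter> (X' \<times> Y')"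

text \<open>The covered vertices \<open>X\<^sub>M\<close> and \<open>Y\<^sub>M\<close> of a matching \<open>M\<close> are
  \<^term>\<open>Domain M\<close> and \<^term>\<open>Range M\<close>.\<close>

definition matching :: "('a \<times> 'b) set \<Rightarrow> ('a \<times> 'b) set \<Rightarrow> bool" where
  "matching E M \<longleftrightarrow>
     M \<subseteq> E \<and> (\<forall>e\<in>M. \<forall>f\<in>M. e \<noteq> f \<longrightarrow> fst e \<noteq> fst f \<and> snd e \<noteq> snd f)"

definition envy_free_matching :: "'a set \<Rightarrow> ('a \<times> 'b) set \<Rightarrow> ('a \<times> 'b) set \<Rightarrow> bool" where
  "envy_free_matching X E M \<longleftrightarrow>
     matching E M \<and> (\<forall>x \<in> X - Domain M. \<forall>y \<in> Range M. (x, y) \<notin> E)"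

definition saturating_matching :: "'a set \<Rightarrow> ('a \<times> 'b) set \<Rightarrow> ('a \<times> 'b) set \<Rightarrow> bool" where
  "saturating_matching A F M \<longleftrightarrow> matching F M \<and> A \<subseteq> Domain M"

definition X_saturated :: "'a set \<Rightarrow> ('a \<times> 'b) set \<Rightarrow> bool" where
  "X_saturated A F \<longleftrightarrow> (\<exists>M. saturating_matching A F M)"

definition perfect_matching_between ::
    "('a \<times> 'b) set \<Rightarrow> 'a set \<Rightarrow> 'b set \<Rightarrow> ('a \<times> 'b) set \<Rightarrow> bool" where
  "perfect_matching_between F A B M \<longleftrightarrow>
     matching (induced F A B) M \<and> Domain M = A \<and> Range M = B"

definition Y_path_saturated :: "'a set \<Rightarrow> 'b set \<Rightarrow> ('a \<times> 'b) set \<Rightarrow> bool" where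
  "Y_path_saturated A B F \<longleftrightarrow>
     (\<exists>k\<ge>1. \<exists>(As :: nat \<Rightarrow> 'a set) (Bs :: nat \<Rightarrow> 'b set).
        A = (\<Union>i\<in>{0..k}. As i) \<and> disjoint_family_on As {0..k} \<and>
        B = (\<Union>i\<in>{1..k}. Bs i) \<and> disjoint_family_on Bs {1..k} \<and>
        (\<forall>i\<in>{1..k}.
           (\<exists>M. perfect_matching_between F (As i) (Bs i) M) \<and>
           (\<forall>y\<in>Bs i. \<exists>x\<in>As (i - 1). (x, y) \<in> F)))"

definition envy_free_partition ::
    "'a set \<Rightarrow> 'b set \<Rightarrow> ('a \<times> 'b) set \<Rightarrow> 'a set \<Rightarrow> 'a set \<Rightarrow> 'b set \<Rightarrow> 'b set \<Rightarrow> bool" where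
  "envy_free_partition X Y E XS XL YS YL \<longleftrightarrow>
     X = XS \<union> XL \<and> XS \<inter> XL = {} \<and>
     Y = YS \<union> YL \<and> YS \<inter> YL = {} \<and>
     induced E XS YL = {} \<and>
     Y_path_saturated XS YS (induced E XS YS) \<and>
     X_saturated XL (induced E XL YL)"

section \<open>Machine model\<close>

text \<open>
  Running times refer to a structured random access machine with finitely many scalar registers
  and zero-initialised, unbounded arrays of natural numbers (a program names only finitely many of
  either). Each assignment, each array store and each evaluation of a test takes one time unit; as
  the program does not depend on the input, the expressions in it have constant size.

  The unit cost is realistic because the only operation producing a larger number is the
  successor: after \<open>t\<close> steps every stored number is at most the largest number in the
  input or the program plus \<open>O(t)\<close>, and so fits into logarithmically many bits.
\<close>

record state =
  reg :: "nat \<Rightarrow> nat"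
  arr :: "nat \<Rightarrow> nat \<Rightarrow> nat"

datatype aexp =
    Const nat
  | Reg nat
  | Get nat aexp
  | Inc aexp
  | Minus aexp aexp

datatype bexp =
    Less aexp aexp
  | Equal aexp aexp
  | Not bexp
  | And bexp bexp

datatype com =
    Skip
  | Assign nat aexp
  | Store nat aexp aexp
  | Seq com com
  | If bexp com com
  | While bexp com

primrec aval :: "aexp \<Rightarrow> state \<Rightarrow> nat" where
  "aval (Const n) s = n"
| "aval (Reg r) s = reg s r"
| "aval (Get a e) s = arr s a (aval e s)"
| "aval (Inc e) s = Suc (aval e s)"
| "aval (Minus e f) s = aval e s - aval f s"

primrec bval :: "bexp \<Rightarrow> state \<Rightarrow> bool" where
  "bval (Less e f) s \<longleftrightarrow> aval e s < aval f s"
| "bval (Equal e f) s \<longleftrightarrow> aval e s = aval f s"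
| "bval (Not b) s \<longleftrightarrow> \<not> bval b s"
| "bval (And b c) s \<longleftrightarrow> bval b s \<and> bval c s"

text \<open>\<open>exec c s t s'\<close>: started in \<open>s\<close>, the program \<open>c\<close> halts after exactly \<open>t\<close> time units
  in \<open>s'\<close>.\<close>

inductive exec :: "com \<Rightarrow> state \<Rightarrow> nat \<Rightarrow> state \<Rightarrow> bool" where
  Skip: "exec Skip s 1 s"
| Assign: "exec (Assign r e) s 1 (s\<lparr>reg := (reg s)(r := aval e s)\<rparr>)"
| Store: "exec (Store a e f) s 1
    (s\<lparr>arr := (arr s)(a := (arr s a)(aval e s := aval f s))\<rparr>)"
| Seq: "exec c s t s' \<Longrightarrow> exec d s' u s'' \<Longrightarrow> exec (Seq c d) s (t + u) s''"
| IfTrue: "bval b s \<Longrightarrow> exec c s t s' \<Longrightarrow> exec (If b c d) s (Suc t) s'"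
| IfFalse: "\<not> bval b s \<Longrightarrow> exec d s t s' \<Longrightarrow> exec (If b c d) s (Suc t) s'"
| WhileFalse: "\<not> bval b s \<Longrightarrow> exec (While b c) s 1 s"
| WhileTrue: "bval b s \<Longrightarrow> exec c s t s' \<Longrightarrow> exec (While b c) s' u s'' \<Longrightarrow>
    exec (While b c) s (Suc (t + u)) s''"

inductive_cases exec_SkipE: "exec Skip s t s'"
inductive_cases exec_AssignE: "exec (Assign r e) s t s'"
inductive_cases exec_StoreE: "exec (Store a e f) s t s'"
inductive_cases exec_SeqE: "exec (Seq c d) s t s'"
inductive_cases exec_IfE: "exec (If b c d) s t s'"
inductive_cases exec_WhileE: "exec (While b c) s t s'"

lemma exec_deterministic:
  "exec c s t s' \<Longrightarrow> exec c s u s'' \<Longrightarrow> u = t \<and> s'' = s'"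
proof (induction arbitrary: u s'' rule: exec.induct)
  case Skip
  then show ?case by (rule exec_SkipE) simp
next
  case Assign
  then show ?case by (rule exec_AssignE) simp
next
  case Store
  then show ?case by (rule exec_StoreE) simp
next
  case Seq
  from Seq.prems show ?case by (rule exec_SeqE) (use Seq.IH in blast)
next
  case IfTrue
  from IfTrue.prems show ?case by (rule exec_IfE) (use IfTrue.hyps IfTrue.IH in blast)+
next
  case IfFalse
  from IfFalse.prems show ?case by (rule exec_IfE) (use IfFalse.hyps IfFalse.IH in blast)+
next
  case WhileFalse
  from WhileFalse.prems show ?case by (rule exec_WhileE) (use WhileFalse.hyps in simp_all)
next
  case WhileTrue
  from WhileTrue.prems show ?case by (rule exec_WhileE) (use WhileTrue.hyps WhileTrue.IH in blast)+
qed

text \<open>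
  Input: a bipartite graph with sides \<open>{..<p}\<close> and \<open>{..<q}\<close>, given as a list of edges in
  arbitrary order. Registers 0, 1, 2 hold \<open>p\<close>, \<open>q\<close> and the number of edges; arrays 0 and 1
  hold the endpoints of the edges; everything else is 0.
\<close>

definition input_state :: "nat \<Rightarrow> nat \<Rightarrow> (nat \<times> nat) list \<Rightarrow> state" where
  "input_state p q es =
     \<lparr>reg = (\<lambda>_. 0)(0 := p, 1 := q, 2 := length es),
      arr = (\<lambda>_ _. 0)
        (0 := (\<lambda>k. if k < length es then fst (es ! k) else 0),
         1 := (\<lambda>k. if k < length es then snd (es ! k) else 0))\<rparr>"

text \<open>
  Output: array 2 marks the vertices of \<open>X\<^sub>L\<close>, array 3 those of \<open>Y\<^sub>S\<close> (any nonzero entry is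
  a mark). Isolated vertices always belong to \<open>X\<^sub>S\<close> and \<open>Y\<^sub>L\<close>, hence are never marked;
  this way a running time bounded in terms of the edges alone is meaningful
  for graphs with many isolated vertices, too.
\<close>

definition output_partition ::
    "nat \<Rightarrow> nat \<Rightarrow> state \<Rightarrow> nat set \<times> nat set \<times> nat set \<times> nat set" where
  "output_partition p q s =
     ({x. x < p \<and> arr s 2 x = 0}, {x. x < p \<and> arr s 2 x \<noteq> 0},
      {y. y < q \<and> arr s 3 y \<noteq> 0}, {y. y < q \<and> arr s 3 y = 0})"

text \<open>The summand 1 in the time bound only matters for graphs without edges, on which a program
  still has to halt.\<close>

definition computes_partitions_in_time :: "com \<Rightarrow> real \<Rightarrow> bool" where
  "computes_partitions_in_time prog C \<longleftrightarrow>
     (\<forall>p q es. distinct es \<and> set es \<subseteq> {..<p} \<times> {..<q} \<longrightarrow>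
        (\<exists>t s XS XL YS YL.
           exec prog (input_state p q es) t s \<and>
           real t \<le> C * (1 + real (length es) * sqrt (real (min p q))) \<and>
           output_partition p q s = (XS, XL, YS, YL) \<and>
           envy_free_partition {..<p} {..<q} (set es) XS XL YS YL))"

end

theory Submission
  imports Defs
begin

text \<open>
  Take a maximum matching and let \<open>X\<^sub>S\<close> consist of the vertices of \<open>X\<close> reachable from unmatched
  ones by alternating paths, and \<open>Y\<^sub>S\<close> of the neighbours of \<open>X\<^sub>S\<close>. Since there is no augmenting path,
  \<open>Y\<^sub>S\<close> is matched into \<open>X\<^sub>S\<close>, and the distance layers show that \<open>G[X\<^sub>S, Y\<^sub>S]\<close> is path-saturated.
  Conversely, an envy-free matching \<open>N\<close> covers in each layer \<open>A\<^sub>i\<close>, \<open>i \<ge> 1\<close>, the partners of all vertices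
  it covers in \<open>B\<^sub>i\<close>; as \<open>N\<close> maps \<open>X\<^sub>S\<close> into \<open>Y\<^sub>S\<close>, counting shows that it covers nothing else in \<open>X\<^sub>S\<close>,
  in particular nothing in \<open>A\<^sub>0\<close>, and then, layer by layer, nothing at all. Uniqueness follows, because the
  \<open>X\<^sub>L\<close>-saturating matching of one partition lies within the \<open>L\<close>-parts of any other.

  For the running time, let \<open>c\<close> be the minimum of \<open>|X|\<close>, \<open>|Y|\<close> and \<open>m\<close>, and \<open>K\<close> about \<open>\<surd>(2 * c)\<close>.
  An auction in which every vertex of \<open>X\<close> scans its edges at most \<open>K\<close> times takes time \<open>O(m * K)\<close> and ends
  with a matching \<open>M\<close> whose labels give vertex covers showing that any matching has at most \<open>|M| + |M| / K\<close>
  edges. Hence at most \<open>K\<close> searches for an augmenting path, each taking time \<open>O(m)\<close>, remain to be done,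
  and the last, unsuccessful one computes the partition.
\<close>

section \<open>Existence and uniqueness of the partition\<close>

lemma matching_fst: "matching E M \<Longrightarrow> (x, y) \<in> M \<Longrightarrow> (x, y') \<in> M \<Longrightarrow> y = y'"
  unfolding matching_def by fastforce

lemma matching_snd: "matching E M \<Longrightarrow> (x, y) \<in> M \<Longrightarrow> (x', y) \<in> M \<Longrightarrow> x = x'"
  unfolding matching_def by fastforce

lemma matching_edge: "matching E M \<Longrightarrow> (x, y) \<in> M \<Longrightarrow> (x, y) \<in> E"
  unfolding matching_def by blast

lemma matchingI:
  assumes "M \<subseteq> E"
    and "\<And>x y y'. (x, y) \<in> M \<Longrightarrow> (x, y') \<in> M \<Longrightarrow> y = y'"
    and "\<And>x x' y. (x, y) \<in> M \<Longrightarrow> (x', y) \<in> M \<Longrightarrow> x = x'"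
  shows "matching E M"
  using assms unfolding matching_def by (metis prod.collapse)

lemma matching_subset: "matching E M \<Longrightarrow> N \<subseteq> M \<Longrightarrow> N \<subseteq> F \<Longrightarrow> matching F N"
  unfolding matching_def by blast

lemma matching_insert:
  assumes "matching E M" "(x, y) \<in> E" "x \<notin> Domain M" "y \<notin> Range M"
  shows "matching E (insert (x, y) M)"
  using assms unfolding matching_def by fastforce

section \<open>Envy-free matchings versus a given partition, and its uniqueness\<close>

lemma saturating_imp_envy_free:
  assumes part: "envy_free_partition X Y E XS XL YS YL"
    and sat: "saturating_matching XL (induced E XL YL) M"
  shows "envy_free_matching X E M"
proof -
  have M: "matching (induced E XL YL) M" "XL \<subseteq> Domain M"
    using sat by (auto simp: saturating_matching_def)
  have "matching E M" "Range M \<subseteq> YL"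
    using M by (auto simp: matching_def induced_def)
  \<comment> \<open>All of \<open>XL\<close> is covered, so an envious vertex would lie in
    \<open>XS\<close> and yet be adjacent to \<open>YL\<close>.\<close>
  moreover have "X - Domain M \<subseteq> XS"
    using part M by (auto simp: envy_free_partition_def)
  moreover have "induced E XS YL = {}"
    using part by (auto simp: envy_free_partition_def)
  ultimately show ?thesis
    unfolding envy_free_matching_def induced_def by blast
qed

text \<open>The form in which path saturation is used: \<open>f\<close> takes a vertex of
  \<open>B\<close> to its partner, \<open>layer\<close> to the index of its part. The neighbour
  \<open>x\<close> in the preceding part of \<open>A\<close> is nobody's partner if that part is the
  initial one, and otherwise the partner of a vertex in a lower layer.\<close>

lemma Y_path_saturated_layers:
  assumes "Y_path_saturated A B F"
  obtains f :: "'b \<Rightarrow> 'a" and layer :: "'b \<Rightarrow> nat"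
  where "inj_on f B" "\<And>y. y \<in> B \<Longrightarrow> f y \<in> A \<and> (f y, y) \<in> F"
    "\<And>y. y \<in> B \<Longrightarrow> \<exists>x\<in>A. (x, y) \<in> F \<and> (\<forall>y'\<in>B. f y' = x \<longrightarrow> layer y' < layer y)"
proof -
  obtain k and As :: "nat \<Rightarrow> 'a set" and Bs :: "nat \<Rightarrow> 'b set" where
    A: "A = (\<Union>i\<in>{0..k}. As i)" and dA: "disjoint_family_on As {0..k}" and
    B: "B = (\<Union>i\<in>{1..k}. Bs i)" and dB: "disjoint_family_on Bs {1..k}" and
    pm: "\<forall>i\<in>{1..k}. \<exists>M. perfect_matching_between F (As i) (Bs i) M" and
    adj: "\<forall>i\<in>{1..k}. \<forall>y\<in>Bs i. \<exists>x\<in>As (i - 1). (x, y) \<in> F"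
    using assms unfolding Y_path_saturated_def by blast
  obtain M where M: "\<And>i. i \<in> {1..k} \<Longrightarrow> perfect_matching_between F (As i) (Bs i) (M i)"
    using pm by metis
  define layer where "layer y = (THE i. i \<in> {1..k} \<and> y \<in> Bs i)" for y
  have layer: "layer y = i" if "i \<in> {1..k}" "y \<in> Bs i" for y i
    unfolding layer_def using that dB unfolding disjoint_family_on_def
    by (intro the_equality) blast+
  have inB: "layer y \<in> {1..k} \<and> y \<in> Bs (layer y)" if "y \<in> B" for y
    using that layer unfolding B by auto
  have "\<exists>x. (x, y) \<in> M (layer y)" if "y \<in> B" for y
    using M inB[OF that] unfolding perfect_matching_between_def by blast
  then obtain f where f: "\<And>y. y \<in> B \<Longrightarrow> (f y, y) \<in> M (layer y)"
    by metis
  have fA: "f y \<in> As (layer y) \<and> (f y, y) \<in> F" if "y \<in> B" for y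
    using f[OF that] M inB[OF that] unfolding perfect_matching_between_def matching_def induced_def
    by blast
  \<comment> \<open>The case \<open>i = 0\<close> is included: its conclusion contradicts
    \<open>layer y \<ge> 1\<close>, so no vertex of \<open>As 0\<close> is a partner.\<close>
  have lay_eq: "layer y = i" if "y \<in> B" "f y \<in> As i" "i \<le> k" for y i
    using dA fA[OF that(1)] inB[OF that(1)] that unfolding disjoint_family_on_def by fastforce
  have "inj_on f B"
  proof (rule inj_onI)
    fix y y' assume yy: "y \<in> B" "y' \<in> B" "f y = f y'"
    then have "layer y = layer y'"
      using lay_eq[of y "layer y'"] fA inB by auto
    then show "y = y'"
      using f[OF yy(1)] f[OF yy(2)] yy M inB[OF yy(1)] matching_fst
      unfolding perfect_matching_between_def by metis
  qed
  moreover have "f y \<in> A \<and> (f y, y) \<in> F" if "y \<in> B" for y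
    using fA[OF that] inB[OF that] unfolding A by auto
  moreover have "\<exists>x\<in>A. (x, y) \<in> F \<and> (\<forall>y'\<in>B. f y' = x \<longrightarrow> layer y' < layer y)"
    if y: "y \<in> B" for y
  proof -
    obtain x where x: "x \<in> As (layer y - 1)" "(x, y) \<in> F"
      using adj inB[OF y] by blast
    have le: "layer y - 1 \<le> k" "0 < layer y"
      using inB[OF y] by auto
    then have "\<forall>y'\<in>B. f y' = x \<longrightarrow> layer y' < layer y"
      using x lay_eq by fastforce
    then show ?thesis
      using x le unfolding A by auto
  qed
  ultimately show thesis
    using that[of f layer] by blast
qed

text \<open>\<open>N\<close> injects the set \<open>T\<close> of covered vertices of
  \<open>XS\<close> into the set \<open>U\<close> of covered vertices of \<open>YS\<close>.
  Conversely \<open>f\<close> injects \<open>U\<close> into \<open>T\<close>, because the neighbour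
  \<open>f y\<close> of a covered \<open>y\<close> must be covered. By finiteness \<open>f\<close>
  maps \<open>U\<close> onto \<open>T\<close>, so that covered vertices of \<open>XS\<close> are
  partners of covered vertices of \<open>YS\<close>; descending through the layers then empties both
  sets.\<close>

lemma envy_free_subset_induced:
  assumes bip: "bipartite_graph X Y E" and part: "envy_free_partition X Y E XS XL YS YL"
    and N: "envy_free_matching X E N"
  shows "N \<subseteq> induced E XL YL"
proof -
  have fin: "finite X" "finite Y" and sub: "E \<subseteq> X \<times> Y"
    using bip by (auto simp: bipartite_graph_def)
  have X: "X = XS \<union> XL" and Y: "Y = YS \<union> YL" "YS \<inter> YL = {}" and noedge: "induced E XS YL = {}"
    and sat: "Y_path_saturated XS YS (induced E XS YS)"
    using part by (auto simp: envy_free_partition_def)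
  have NE: "matching E N" and envy: "\<And>x y. x \<in> X \<Longrightarrow> y \<in> Range N \<Longrightarrow> (x, y) \<in> E \<Longrightarrow> x \<in> Domain N"
    using N by (auto simp: envy_free_matching_def)
  obtain f layer where f: "inj_on f YS" "\<And>y. y \<in> YS \<Longrightarrow> f y \<in> XS \<and> (f y, y) \<in> induced E XS YS"
    and lay: "\<And>y. y \<in> YS \<Longrightarrow> \<exists>x\<in>XS. (x, y) \<in> induced E XS YS \<and>
      (\<forall>y'\<in>YS. f y' = x \<longrightarrow> layer y' < (layer y :: nat))"
    using Y_path_saturated_layers[OF sat] by metis
  define T where "T = Domain N \<inter> XS"
  define U where "U = Range N \<inter> YS"
  have finTU: "finite T" "finite U"
    using fin X Y by (auto simp: T_def U_def)
  have "\<exists>y. (x, y) \<in> N" if "x \<in> T" for x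
    using that by (auto simp: T_def)
  then obtain h where h: "\<And>x. x \<in> T \<Longrightarrow> (x, h x) \<in> N"
    by metis
  have hU: "h x \<in> U" if "x \<in> T" for x
    using h[OF that] that matching_edge[OF NE] noedge sub Y unfolding T_def U_def induced_def by blast
  have "inj_on h T"
    using h matching_snd[OF NE] by (metis inj_onI)
  then have "card T \<le> card U"
    using hU finTU by (metis card_inj_on_le image_subsetI)
  moreover have fT: "f ` U \<subseteq> T"
  proof
    fix x assume "x \<in> f ` U"
    then obtain y where "y \<in> Range N" "y \<in> YS" "x = f y"
      by (auto simp: U_def)
    then show "x \<in> T"
      using f(2)[of y] envy[of x y] X by (auto simp: T_def induced_def)
  qed
  moreover have "inj_on f U"
    using f(1) by (rule inj_on_subset) (auto simp: U_def)
  ultimately have TU: "f ` U = T"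
    using finTU by (metis card_image card_seteq)
  \<comment> \<open>Descent: the neighbour \<open>x\<close> from the preceding part is covered by
    envy-freeness, hence equals \<open>f y'\<close> for some \<open>y'\<close> in \<open>U\<close>
    of lower layer.\<close>
  have "y \<notin> U" for y
  proof (induction "layer y" arbitrary: y rule: less_induct)
    case less
    show ?case
    proof
      assume y: "y \<in> U"
      then obtain x where x: "x \<in> XS" "(x, y) \<in> induced E XS YS"
        "\<And>y'. y' \<in> YS \<Longrightarrow> f y' = x \<Longrightarrow> layer y' < layer y"
        using lay[of y] unfolding U_def by auto
      then have "x \<in> T"
        using envy y X unfolding T_def U_def induced_def by blast
      then obtain y' where "y' \<in> U" "f y' = x"
        using TU by auto
      then show False
        using less x unfolding U_def by blast
    qed
  qed
  then have "U = {}"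
    by blast
  then have "T = {}"
    using TU by simp
  show ?thesis
  proof (rule subrelI)
    fix x y assume xy: "(x, y) \<in> N"
    then have "(x, y) \<in> E"
      using NE matching_edge by fast
    with xy sub \<open>U = {}\<close> \<open>T = {}\<close> X Y show "(x, y) \<in> induced E XL YL"
      unfolding T_def U_def induced_def by blast
  qed
qed

text \<open>Path saturation gives each vertex of \<open>YS\<close> a neighbour in \<open>XS\<close>,
  and no edge leaves \<open>XS\<close> for \<open>YL\<close>. Uniqueness thus only has to be shown
  for the side \<open>X\<close>.\<close>

lemma envy_free_partition_YS:
  assumes bip: "bipartite_graph X Y E" and part: "envy_free_partition X Y E XS XL YS YL"
  shows "YS = E `` XS"
proof -
  have *: "E \<subseteq> X \<times> Y" "Y = YS \<union> YL" "induced E XS YL = {}"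
    "Y_path_saturated XS YS (induced E XS YS)"
    using bip part by (auto simp: bipartite_graph_def envy_free_partition_def)
  obtain f layer where "\<And>y. y \<in> YS \<Longrightarrow> \<exists>x\<in>XS. (x, y) \<in> induced E XS YS \<and>
      (\<forall>y'\<in>YS. f y' = x \<longrightarrow> layer y' < (layer y :: nat))"
    using Y_path_saturated_layers[OF *(4)] by metis
  then have "YS \<subseteq> E `` XS"
    unfolding induced_def by blast
  moreover have "E `` XS \<subseteq> YS"
    using * unfolding induced_def by blast
  ultimately show ?thesis
    by blast
qed

text \<open>The saturating matching of \<open>XL\<close> is envy-free, so it lies within the L-parts
  of the other partition. This gives one inclusion, and symmetry the other.\<close>

lemma envy_free_partition_unique:
  assumes bip: "bipartite_graph X Y E"
    and part: "envy_free_partition X Y E XS XL YS YL" "envy_free_partition X Y E XS' XL' YS' YL'"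
  shows "XS = XS' \<and> XL = XL' \<and> YS = YS' \<and> YL = YL'"
proof -
  have sub: "XL \<subseteq> XL'"
    if part: "envy_free_partition X Y E XS XL YS YL" "envy_free_partition X Y E XS' XL' YS' YL'"
    for XS XL YS YL XS' XL' YS' YL'
  proof -
    obtain M where M: "saturating_matching XL (induced E XL YL) M"
      using part(1) by (auto simp: envy_free_partition_def X_saturated_def)
    then have "M \<subseteq> induced E XL' YL'"
      using saturating_imp_envy_free[OF part(1)] envy_free_subset_induced[OF bip part(2)] by blast
    then show ?thesis
      using M by (auto simp: saturating_matching_def induced_def)
  qed
  have XL: "XL = XL'"
    using sub[OF part] sub[OF part(2,1)] by blast
  then have XS: "XS = XS'"
    using part by (auto simp: envy_free_partition_def)
  then have YS: "YS = YS'"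
    using envy_free_partition_YS[OF bip] part by metis
  then have "YL = YL'"
    using part by (auto simp: envy_free_partition_def)
  with XL XS YS show ?thesis
    by blast
qed

section \<open>Vertices reachable by alternating walks\<close>

primrec alt_layer :: "'a set \<Rightarrow> ('a \<times> 'b) set \<Rightarrow> ('a \<times> 'b) set \<Rightarrow> nat \<Rightarrow> 'a set" where
  "alt_layer X E M 0 = X - Domain M"
| "alt_layer X E M (Suc n) = {x'. \<exists>x\<in>alt_layer X E M n. \<exists>y. (x, y) \<in> E \<and> (x', y) \<in> M}"

definition alt_reach :: "'a set \<Rightarrow> ('a \<times> 'b) set \<Rightarrow> ('a \<times> 'b) set \<Rightarrow> 'a set" where
  "alt_reach X E M = (\<Union>n. alt_layer X E M n)"

text \<open>Walks may repeat vertices, so the sets \<open>alt_layer\<close> overlap; the first one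
  containing \<open>x\<close> counts.\<close>

definition alt_dist :: "'a set \<Rightarrow> ('a \<times> 'b) set \<Rightarrow> ('a \<times> 'b) set \<Rightarrow> 'a \<Rightarrow> nat" where
  "alt_dist X E M x = (LEAST n. x \<in> alt_layer X E M n)"

lemma alt_dist_layer: "x \<in> alt_reach X E M \<Longrightarrow> x \<in> alt_layer X E M (alt_dist X E M x)"
  unfolding alt_reach_def alt_dist_def by (auto intro: LeastI)

lemma alt_dist_le: "x \<in> alt_layer X E M n \<Longrightarrow> alt_dist X E M x \<le> n"
  unfolding alt_dist_def by (rule Least_le)

lemma alt_reach_free: "X - Domain M \<subseteq> alt_reach X E M"
  unfolding alt_reach_def using alt_layer.simps(1)[of X E M] by blast

lemma alt_reach_step:
  assumes "x \<in> alt_reach X E M" "(x, y) \<in> E" "(x', y) \<in> M"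
  shows "x' \<in> alt_reach X E M"
proof -
  obtain n where "x \<in> alt_layer X E M n"
    using assms(1) by (auto simp: alt_reach_def)
  then have "x' \<in> alt_layer X E M (Suc n)"
    using assms by auto
  then show ?thesis
    unfolding alt_reach_def by blast
qed

lemma alt_reach_subset: "matching E M \<Longrightarrow> E \<subseteq> X \<times> Y \<Longrightarrow> alt_reach X E M \<subseteq> X"
proof -
  assume *: "matching E M" "E \<subseteq> X \<times> Y"
  have "alt_layer X E M n \<subseteq> X" for n
    using * by (cases n) (auto simp: matching_def)
  then show ?thesis
    unfolding alt_reach_def by blast
qed

lemma alt_dist_free_iff:
  assumes "x \<in> alt_reach X E M"
  shows "alt_dist X E M x = 0 \<longleftrightarrow> x \<notin> Domain M"
  using alt_dist_layer[OF assms] alt_dist_le[of x X E M 0] assms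
  by (cases "alt_dist X E M x") (fastforce simp: alt_reach_def)+

text \<open>A walk can enter \<open>x\<close> only through its unique partner \<open>y\<close>, so
  the last but one vertex of \<open>X\<close> on a shortest walk is a neighbour of \<open>y\<close>
  and exactly one step closer. This yields the adjacency to the preceding layer as well as the
  descent needed for augmentation.\<close>

lemma alt_dist_pred:
  assumes M: "matching E M" and x: "x \<in> alt_reach X E M" and xy: "(x, y) \<in> M"
  obtains x' where "x' \<in> alt_reach X E M" "(x', y) \<in> E"
    "alt_dist X E M x = Suc (alt_dist X E M x')"
proof -
  have "alt_dist X E M x \<noteq> 0"
    using alt_dist_free_iff[OF x] xy by blast
  then obtain n where n: "alt_dist X E M x = Suc n"
    by (metis not0_implies_Suc)
  then obtain x' y' where *: "x' \<in> alt_layer X E M n" "(x', y') \<in> E" "(x, y') \<in> M"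
    using alt_dist_layer[OF x] by auto
  then have "y' = y"
    using matching_fst[OF M] xy by metis
  have x': "x' \<in> alt_reach X E M"
    using * by (auto simp: alt_reach_def)
  have "x \<in> alt_layer X E M (Suc (alt_dist X E M x'))"
    using alt_dist_layer[OF x'] * by auto
  then have "Suc n \<le> Suc (alt_dist X E M x')"
    using alt_dist_le n by metis
  moreover have "alt_dist X E M x' \<le> n"
    using alt_dist_le * by metis
  ultimately show thesis
    using that x' * \<open>y' = y\<close> n by simp
qed

text \<open>The path is flipped from its unmatched end in \<open>Y\<close>, so that the part of the path not yet
  flipped only involves vertices of smaller rank, whose partners are unchanged.\<close>

lemma matching_augment:
  fixes rank :: "'a \<Rightarrow> nat"
  assumes "matching E M" "finite M"
    and "\<And>x. x \<in> R \<Longrightarrow> rank x \<le> rank z \<Longrightarrow> x \<in> Domain M \<Longrightarrow>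
      \<exists>y x'. (x, y) \<in> M \<and> x' \<in> R \<and> (x', y) \<in> E \<and> rank x' < rank x"
    and "z \<in> R" "(z, y) \<in> E" "y \<notin> Range M"
  shows "\<exists>M'. matching E M' \<and> card M' = Suc (card M)"
  using assms
proof (induction "rank z" arbitrary: z y M rule: less_induct)
  case less
  show ?case
  proof (cases "z \<in> Domain M")
    case False
    then show ?thesis
      using matching_insert[OF less.prems(1,5) False less.prems(6)] less.prems(2,6)
      by (metis Range.intros card_insert_disjoint)
  next
    case True
    then obtain y' z' where z': "(z, y') \<in> M" "z' \<in> R" "(z', y') \<in> E" "rank z' < rank z"
      using less.prems(3,4) by blast
    \<comment> \<open>Exchanging one edge at \<open>z\<close> keeps the size and moves the uncovered
      end of the path from \<open>y\<close> back to \<open>y'\<close>.\<close>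
    define M' where "M' = insert (z, y) (M - {(z, y')})"
    have z_free: "z \<notin> Domain (M - {(z, y')})"
      using z'(1) matching_fst[OF less.prems(1)] by blast
    have y_free: "y \<notin> Range (M - {(z, y')})"
      using less.prems(6) by blast
    have M'm: "matching E M'"
      unfolding M'_def using z_free y_free less.prems(5)
        matching_subset[OF less.prems(1)] less.prems(1)
      by (intro matching_insert) (auto simp: matching_def)
    have fin: "finite M'"
      using less.prems(2) by (simp add: M'_def)
    have card: "card M' = card M"
    proof -
      have "card M' = Suc (card (M - {(z, y')}))"
        unfolding M'_def using y_free less.prems(2) by (intro card_insert_disjoint) auto
      then show ?thesis
        using z'(1) less.prems(2) by (metis card_Suc_Diff1)
    qed
    have y': "y' \<notin> Range M'"
      using z'(1) less.prems(6) matching_snd[OF less.prems(1)] unfolding M'_def by blast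
    have "\<exists>y x'. (x, y) \<in> M' \<and> x' \<in> R \<and> (x', y) \<in> E \<and> rank x' < rank x"
      if "x \<in> R" "rank x \<le> rank z'" "x \<in> Domain M'" for x
    proof -
      have "x \<noteq> z" "rank x \<le> rank z"
        using that(2) z'(4) by auto
      moreover from this have "x \<in> Domain M"
        using that(3) by (auto simp: M'_def)
      ultimately show ?thesis
        using less.prems(3)[OF that(1)] unfolding M'_def by blast
    qed
    from less.hyps[OF z'(4) M'm fin this z'(2,3) y'] show ?thesis
      using card by simp
  qed
qed

text \<open>An uncovered neighbour of a reachable vertex would complete an augmenting path, flipped
  with \<open>alt_dist\<close> as rank.\<close>

lemma maximum_matching_closed:
  assumes "matching E M" "finite M" and max: "\<And>M'. matching E M' \<Longrightarrow> card M' \<le> card M"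
    and "x \<in> alt_reach X E M" "(x, y) \<in> E"
  shows "y \<in> Range M"
proof (rule ccontr)
  assume y: "y \<notin> Range M"
  have "\<exists>y x'. (u, y) \<in> M \<and> x' \<in> alt_reach X E M \<and> (x', y) \<in> E \<and> alt_dist X E M x' < alt_dist X E M u"
    if "u \<in> alt_reach X E M" "u \<in> Domain M" for u
    using that alt_dist_pred[OF assms(1)] by (metis DomainE lessI)
  then obtain M' where "matching E M'" "card M' = Suc (card M)"
    using matching_augment[OF assms(1,2) _ assms(4,5) y, of "alt_dist X E M"] by blast
  then show False
    using max by fastforce
qed

text \<open>\<open>closed\<close> says that there is no augmenting path. The parts of
  \<open>X\<close> are the distance classes and those of \<open>Y\<close> their partners. Both the
  existence proof and the correctness of the last search rest on this lemma.\<close>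

lemma envy_free_partition_alt_reach:
  assumes bip: "bipartite_graph X Y E" and M: "matching E M"
    and closed: "\<And>x y. x \<in> alt_reach X E M \<Longrightarrow> (x, y) \<in> E \<Longrightarrow> y \<in> Range M"
  shows "envy_free_partition X Y E (alt_reach X E M) (X - alt_reach X E M)
    (E `` alt_reach X E M) (Y - E `` alt_reach X E M)"
proof -
  let ?R = "alt_reach X E M" and ?d = "alt_dist X E M"
  have fin: "finite X" and sub: "E \<subseteq> X \<times> Y"
    using bip by (auto simp: bipartite_graph_def)
  have R: "?R \<subseteq> X"
    using alt_reach_subset[OF M sub] .
  \<comment> \<open>The successor ensures \<open>k \<ge> 1\<close>; the last layers may be
    empty.\<close>
  define k where "k = Suc (Max (?d ` ?R))"
  have dk: "?d x \<le> k" if "x \<in> ?R" for x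
    unfolding k_def using that finite_subset[OF R fin] by (intro le_SucI Max_ge) auto
  define As where "As i = {x \<in> ?R. ?d x = i}" for i
  define Bs where "Bs i = M `` As i" for i
  have YS: "E `` ?R = (\<Union>i\<in>{1..k}. Bs i)"
  proof (intro equalityI subsetI)
    fix y assume "y \<in> E `` ?R"
    then obtain x x' where x: "x \<in> ?R" "(x, y) \<in> E" "(x', y) \<in> M"
      using closed by blast
    then have x': "x' \<in> ?R"
      using alt_reach_step by metis
    then have "?d x' \<noteq> 0"
      using alt_dist_free_iff[OF x'] x by blast
    then show "y \<in> (\<Union>i\<in>{1..k}. Bs i)"
      using x x' dk[OF x'] unfolding Bs_def As_def by (auto intro!: bexI[of _ "?d x'"])
  next
    fix y assume "y \<in> (\<Union>i\<in>{1..k}. Bs i)"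
    then obtain x where x: "x \<in> ?R" "(x, y) \<in> M"
      unfolding Bs_def As_def by auto
    then show "y \<in> E `` ?R"
      using alt_dist_pred[OF M x] by blast
  qed
  have pm: "perfect_matching_between (induced E ?R (E `` ?R)) (As i) (Bs i) (M \<inter> As i \<times> UNIV)"
    if i: "i \<in> {1..k}" for i
  proof -
    have "As i \<subseteq> Domain M"
      using i alt_dist_free_iff unfolding As_def by force
    moreover have "M \<inter> As i \<times> UNIV \<subseteq> induced (induced E ?R (E `` ?R)) (As i) (Bs i)"
      using matching_edge[OF M] unfolding induced_def Bs_def As_def by auto
    moreover from calculation have "Domain (M \<inter> As i \<times> UNIV) = As i"
      "Range (M \<inter> As i \<times> UNIV) = Bs i"
      unfolding Bs_def by blast+
    ultimately show ?thesis
      unfolding perfect_matching_between_def using matching_subset[OF M] by simp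
  qed
  have adj: "\<exists>x\<in>As (i - 1). (x, y) \<in> induced E ?R (E `` ?R)" if y: "i \<in> {1..k}" "y \<in> Bs i" for i y
  proof -
    obtain x where x: "x \<in> ?R" "?d x = i" "(x, y) \<in> M"
      using y unfolding Bs_def As_def by blast
    then obtain x' where "x' \<in> ?R" "(x', y) \<in> E" "?d x = Suc (?d x')"
      using alt_dist_pred[OF M] by metis
    then show ?thesis
      using x unfolding As_def induced_def by auto
  qed
  have AR: "?R = (\<Union>i\<in>{0..k}. As i)"
    using dk by (auto simp: As_def)
  have dA: "disjoint_family_on As {0..k}"
    by (auto simp: As_def disjoint_family_on_def)
  have dB: "disjoint_family_on Bs {1..k}"
  proof -
    have "i = j" if "y \<in> Bs i" "y \<in> Bs j" for i j y
      using that matching_snd[OF M] unfolding As_def Bs_def by blast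
    then show ?thesis
      by (auto simp: disjoint_family_on_def)
  qed
  have k: "k \<ge> 1"
    by (simp add: k_def)
  have path_sat: "Y_path_saturated ?R (E `` ?R) (induced E ?R (E `` ?R))"
    unfolding Y_path_saturated_def
  proof (intro exI conjI ballI)
    show "perfect_matching_between (induced E ?R (E `` ?R)) (As i) (Bs i) (M \<inter> As i \<times> UNIV)"
      if "i \<in> {1..k}" for i
      using pm[OF that] .
    show "\<exists>x\<in>As (i - 1). (x, y) \<in> induced E ?R (E `` ?R)" if "i \<in> {1..k}" "y \<in> Bs i" for i y
      using adj[OF that] .
  qed (fact k AR dA YS dB)+
  \<comment> \<open>Every unreached vertex is covered, and its partner has no reached neighbour, as
    otherwise the vertex would be reached itself.\<close>
  let ?M = "M \<inter> (X - ?R) \<times> UNIV"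
  have "y \<notin> E `` ?R" if "(x, y) \<in> M" "x \<notin> ?R" for x y
    using that alt_reach_step[of _ X E M y x] by blast
  then have "?M \<subseteq> induced E (X - ?R) (Y - E `` ?R)"
    using matching_edge[OF M] sub unfolding induced_def by blast
  moreover have "X - ?R \<subseteq> Domain ?M"
    using alt_reach_free[of X M E] by blast
  ultimately have "saturating_matching (X - ?R) (induced E (X - ?R) (Y - E `` ?R)) ?M"
    unfolding saturating_matching_def using matching_subset[OF M] by blast
  then have "X_saturated (X - ?R) (induced E (X - ?R) (Y - E `` ?R))"
    unfolding X_saturated_def by blast
  moreover have "induced E ?R (Y - E `` ?R) = {}" "E `` ?R \<subseteq> Y"
    using sub unfolding induced_def by blast+
  ultimately show ?thesis
    unfolding envy_free_partition_def using R path_sat by blast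
qed

section \<open>Existence from a maximum matching\<close>

lemma maximum_matching_exists:
  assumes "finite E"
  obtains M where "matching E M" "finite M" "\<And>M'. matching E M' \<Longrightarrow> card M' \<le> card M"
proof -
  have "{M. matching E M} \<subseteq> Pow E"
    by (auto simp: matching_def)
  then have fin: "finite (card ` {M. matching E M})"
    using assms by (meson finite_Pow_iff finite_imageI finite_subset)
  have "matching E {}"
    by (simp add: matching_def)
  then have "Max (card ` {M. matching E M}) \<in> card ` {M. matching E M}"
    using fin by (intro Max_in) auto
  then obtain M where "matching E M" "card M = Max (card ` {M. matching E M})"
    by auto
  moreover from this have "card M' \<le> card M" if "matching E M'" for M'
    using that fin by simp
  moreover have "finite M"
    using assms \<open>matching E M\<close> by (auto simp: matching_def intro: finite_subset)
  ultimately show thesis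
    using that by blast
qed

lemma envy_free_partition_exists:
  assumes bip: "bipartite_graph X Y E"
  shows "\<exists>XS XL YS YL. envy_free_partition X Y E XS XL YS YL"
proof -
  have "finite E"
    using bip by (auto simp: bipartite_graph_def intro: finite_subset)
  then obtain M where M: "matching E M" "finite M" "\<And>M'. matching E M' \<Longrightarrow> card M' \<le> card M"
    using maximum_matching_exists by blast
  then show ?thesis
    using envy_free_partition_alt_reach[OF bip M(1)] maximum_matching_closed[OF M] by blast
qed

lemma envy_free_partition_properties:
  assumes bip: "bipartite_graph X Y E"
  shows "(\<exists>!(XS, XL, YS, YL). envy_free_partition X Y E XS XL YS YL) \<and>
      (\<forall>XS XL YS YL. envy_free_partition X Y E XS XL YS YL \<longrightarrow>
         (\<exists>M. saturating_matching XL (induced E XL YL) M) \<and>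
         (\<forall>M. saturating_matching XL (induced E XL YL) M \<longrightarrow> envy_free_matching X E M) \<and>
         (\<forall>M. envy_free_matching X E M \<longrightarrow> M \<subseteq> induced E XL YL))"
proof (intro conjI allI impI)
  obtain XS XL YS YL where "envy_free_partition X Y E XS XL YS YL"
    using envy_free_partition_exists[OF bip] by blast
  then show "\<exists>!(XS, XL, YS, YL). envy_free_partition X Y E XS XL YS YL"
    by (intro ex1I[of _ "(XS, XL, YS, YL)"])
      (simp_all add: split_beta envy_free_partition_unique[OF bip] prod_eq_iff)
next
  fix XS XL YS YL assume part: "envy_free_partition X Y E XS XL YS YL"
  then show "\<exists>M. saturating_matching XL (induced E XL YL) M"
    by (simp add: envy_free_partition_def X_saturated_def)
  show "envy_free_matching X E M" if "saturating_matching XL (induced E XL YL) M" for M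
    using saturating_imp_envy_free[OF part that] .
  show "M \<subseteq> induced E XL YL" if "envy_free_matching X E M" for M
    using envy_free_subset_induced[OF bip part that] .
qed


section \<open>Matching algorithms on edge lists\<close>

locale edge_list =
  fixes p q :: nat and es :: "(nat \<times> nat) list"
  assumes edges: "set es \<subseteq> {..<p} \<times> {..<q}"
begin

abbreviation "m \<equiv> length es"
abbreviation "src j \<equiv> fst (es ! j)"
abbreviation "tgt j \<equiv> snd (es ! j)"

text \<open>The algorithms visit endpoints of edges only, so that their number is bounded by
  \<open>m\<close> however many isolated vertices there are.\<close>

definition srcs :: "nat set" where "srcs = (\<lambda>j. src j) ` {..<m}"
definition tgts :: "nat set" where "tgts = (\<lambda>j. tgt j) ` {..<m}"

lemma src_in [simp, intro]: "j < m \<Longrightarrow> src j \<in> srcs"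
  by (auto simp: srcs_def)

lemma tgt_in [simp, intro]: "j < m \<Longrightarrow> tgt j \<in> tgts"
  by (auto simp: tgts_def)

lemma finite_srcs [simp]: "finite srcs" and finite_tgts [simp]: "finite tgts"
  by (simp_all add: srcs_def tgts_def)

lemma card_srcs: "card srcs \<le> m" and card_tgts: "card tgts \<le> m"
  unfolding srcs_def tgts_def by (metis card_image_le card_lessThan finite_lessThan)+

lemma srcs_less: "x \<in> srcs \<Longrightarrow> x < p"
  using edges nth_mem by (fastforce simp: srcs_def)

lemma tgts_less: "y \<in> tgts \<Longrightarrow> y < q"
  using edges nth_mem by (fastforce simp: tgts_def)

lemma edge_nth: "j < m \<Longrightarrow> (src j, tgt j) \<in> set es"
  by simp

lemma edge_cases:
  assumes "(x, y) \<in> set es"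
  obtains j where "j < m" "src j = x" "tgt j = y"
  using assms by (metis fst_conv in_set_conv_nth snd_conv)

lemma edge_src: "(x, y) \<in> set es \<Longrightarrow> x \<in> srcs"
  by (metis edge_cases src_in)

lemma edge_tgt: "(x, y) \<in> set es \<Longrightarrow> y \<in> tgts"
  by (metis edge_cases tgt_in)


subsection \<open>Matchings as partner arrays\<close>

text \<open>In all arrays of vertices or edges, \<open>0\<close> stands for none and \<open>Suc i\<close> for \<open>i\<close>.\<close>

definition mates :: "(nat \<Rightarrow> nat) \<Rightarrow> bool" where
  "mates g \<longleftrightarrow> (\<forall>x y. g y = Suc x \<longrightarrow> (x, y) \<in> set es) \<and>
     (\<forall>x y y'. g y = Suc x \<longrightarrow> g y' = Suc x \<longrightarrow> y = y')"

definition num_mates :: "(nat \<Rightarrow> nat) \<Rightarrow> nat" where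
  "num_mates g = card {y. g y \<noteq> 0}"

lemma mates_edge: "mates g \<Longrightarrow> g y = Suc x \<Longrightarrow> (x, y) \<in> set es"
  by (auto simp: mates_def)

lemma mates_inj: "mates g \<Longrightarrow> g y = Suc x \<Longrightarrow> g y' = Suc x \<Longrightarrow> y = y'"
  by (auto simp: mates_def)

lemma mates_inj':
  assumes "mates g" "g y \<noteq> 0" "g y = g y'"
  shows "y = y'"
proof -
  obtain x where "g y = Suc x"
    using assms(2) not0_implies_Suc by blast
  then show ?thesis
    using mates_inj[OF assms(1)] assms(3) by metis
qed

lemma mates_zero: "mates (\<lambda>_. 0)"
  by (simp add: mates_def)

lemma mates_edge': "mates g \<Longrightarrow> g y \<noteq> 0 \<Longrightarrow> (g y - 1, y) \<in> set es"
  using mates_edge[of g y "g y - 1"] by simp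

lemma mates_subset: "mates g \<Longrightarrow> {y. g y \<noteq> 0} \<subseteq> tgts"
  using mates_edge' edge_tgt by blast

lemma finite_mates [simp]: "mates g \<Longrightarrow> finite {y. g y \<noteq> 0}"
  using mates_subset finite_subset finite_tgts by blast

text \<open>Together with the next two bounds this limits every matching by
  \<open>min m (min p q)\<close>, the number from which the level bound is computed.\<close>

lemma num_mates_le_m: "mates g \<Longrightarrow> num_mates g \<le> m"
  unfolding num_mates_def using card_mono[OF finite_tgts mates_subset] card_tgts by fastforce

lemma num_mates_le_q:
  assumes g: "mates g"
  shows "num_mates g \<le> q"
proof -
  have "{y. g y \<noteq> 0} \<subseteq> {..<q}"
    using mates_subset[OF g] tgts_less by blast
  then have "num_mates g \<le> card {..<q}"
    unfolding num_mates_def by (rule card_mono[OF finite_lessThan])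
  then show ?thesis
    by simp
qed

lemma num_mates_le_p:
  assumes g: "mates g"
  shows "num_mates g \<le> p"
proof -
  have "inj_on g {y. g y \<noteq> 0}"
  proof (rule inj_onI)
    fix y y' assume "y \<in> {y. g y \<noteq> 0}" "g y = g y'"
    then show "y = y'"
      using mates_inj'[OF g] by simp
  qed
  moreover have "g ` {y. g y \<noteq> 0} \<subseteq> {1..p}"
  proof
    fix i assume "i \<in> g ` {y. g y \<noteq> 0}"
    then obtain y where "g y \<noteq> 0" "i = g y"
      by blast
    then show "i \<in> {1..p}"
      using srcs_less[OF edge_src[OF mates_edge'[OF g]], of y] by auto
  qed
  ultimately have "num_mates g \<le> card {1..p}"
    unfolding num_mates_def using card_inj_on_le by blast
  then show ?thesis
    by simp
qed

lemma matesI: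
  assumes "\<And>x y. g y = Suc x \<Longrightarrow> (x, y) \<in> set es"
    and "\<And>x y y'. g y = Suc x \<Longrightarrow> g y' = Suc x \<Longrightarrow> y = y'"
  shows "mates g"
  unfolding mates_def using assms by iprover

lemma mates_update:
  assumes "mates g" "(x, y) \<in> set es" "\<And>y'. g y' \<noteq> Suc x"
  shows "mates (g(y := Suc x))"
proof (rule matesI)
  show "(x', y') \<in> set es" if "(g(y := Suc x)) y' = Suc x'" for x' y'
    using that assms(2) mates_edge[OF assms(1), of y' x'] by (cases "y' = y") simp_all
  show "y' = y''" if "(g(y := Suc x)) y' = Suc x'" "(g(y := Suc x)) y'' = Suc x'" for x' y' y''
    using that assms(3) mates_inj[OF assms(1), of y' x' y'']
    by (cases "y' = y"; cases "y'' = y") simp_all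
qed

lemma num_mates_update:
  assumes "mates g" "g y = 0"
  shows "num_mates (g(y := Suc x)) = Suc (num_mates g)"
proof -
  have "{z. (g(y := Suc x)) z \<noteq> 0} = insert y {z. g z \<noteq> 0}"
    by auto
  then show ?thesis
    unfolding num_mates_def using card_insert_disjoint[OF finite_mates[OF assms(1)], of y] assms(2)
    by (metis (mono_tags) mem_Collect_eq)
qed

lemma mates_remove:
  assumes "mates g"
  shows "mates (g(y := 0))"
proof (rule matesI)
  show "(x', y') \<in> set es" if "(g(y := 0)) y' = Suc x'" for x' y'
    using that mates_edge[OF assms, of y' x'] by (cases "y' = y") simp_all
  show "y' = y''" if "(g(y := 0)) y' = Suc x'" "(g(y := 0)) y'' = Suc x'" for x' y' y''
    using that mates_inj[OF assms, of y' x' y''] by (cases "y' = y"; cases "y'' = y") simp_all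
qed

text \<open>The elementary move of augmentation: \<open>x\<close> leaves \<open>y'\<close> for the
  free \<open>y\<close>. It is a removal followed by an insertion.\<close>

lemma mates_shift:
  assumes g: "mates g" and "(x, y) \<in> set es" "g y = 0" "g y' = Suc x"
  shows "mates (g(y := Suc x, y' := 0))" "num_mates (g(y := Suc x, y' := 0)) = num_mates g"
proof -
  have ne: "y \<noteq> y'"
    using assms by auto
  have *: "(g(y' := 0)) z \<noteq> Suc x" for z
    using mates_inj[OF g] assms by auto
  have eq: "g(y := Suc x, y' := 0) = (g(y' := 0))(y := Suc x)"
    using ne by auto
  show "mates (g(y := Suc x, y' := 0))"
    unfolding eq using mates_update[OF mates_remove[OF g]] assms * by blast
  have "Suc (num_mates (g(y' := 0))) = num_mates g"
    using num_mates_update[OF mates_remove[OF g, of y'], of y' x] assms fun_upd_triv[of g y'] by simp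
  then show "num_mates (g(y := Suc x, y' := 0)) = num_mates g"
    unfolding eq using num_mates_update[OF mates_remove[OF g, of y'], of y x] assms ne by simp
qed


subsection \<open>Labels certify near-maximality\<close>

text \<open>For each \<open>t \<in> {1..K}\<close> the vertices in \<open>Y\<close> of label at least \<open>t\<close> together with the matched
  vertices in \<open>X\<close> of level at most \<open>t\<close> cover all edges, and a matching edge is covered twice only
  for a single \<open>t\<close>. Averaging over \<open>t\<close> yields a small cover.\<close>

lemma num_mates_le_level:
  assumes g: "mates g" and h: "mates h"
    and free: "\<And>y. g y = 0 \<Longrightarrow> lab y = 0"
    and eq: "\<And>x y. g y = Suc x \<Longrightarrow> lab y = lev x"
    and slack: "\<And>x y. (x, y) \<in> set es \<Longrightarrow> lev x \<le> Suc (lab y)"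
    and dead: "\<And>x y. (x, y) \<in> set es \<Longrightarrow> (\<And>y'. g y' \<noteq> Suc x) \<Longrightarrow> K \<le> lab y"
    and t: "1 \<le> t" "t \<le> K"
  shows "num_mates h \<le> num_mates g + card {y. g y \<noteq> 0 \<and> lab y = t}"
proof -
  let ?G = "{y. g y \<noteq> 0}" and ?H = "{y. h y \<noteq> 0}"
  let ?hi = "{y. g y \<noteq> 0 \<and> t \<le> lab y}" and ?lo = "{y. g y \<noteq> 0 \<and> lab y \<le> t}"
  let ?Hlo = "{y. h y \<noteq> 0 \<and> lab y < t}"
  have fin: "finite ?hi" "finite ?lo"
    by (rule finite_subset[OF _ finite_mates[OF g]], blast)+
  \<comment> \<open>The other end \<open>x\<close> of such an edge of \<open>h\<close> is matched by
    \<open>g\<close>, since otherwise \<open>dead\<close> would give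
    \<open>lab y \<ge> K \<ge> t\<close>. By \<open>slack\<close> its level is at most
    \<open>Suc (lab y)\<close>, hence at most \<open>t\<close>.\<close>
  have "\<exists>y'. g y' = h y \<and> lab y' \<le> t" if y: "y \<in> ?Hlo" for y
  proof -
    obtain x where x: "h y = Suc x" "(x, y) \<in> set es"
      using y mates_edge[OF h] not0_implies_Suc by blast
    then obtain y' where y': "g y' = Suc x"
      using dead y t by fastforce
    then have "lab y' \<le> t"
      using eq[OF y'] slack[OF x(2)] y by auto
    then show ?thesis
      using x y' by auto
  qed
  then obtain f where f: "\<And>y. y \<in> ?Hlo \<Longrightarrow> g (f y) = h y \<and> lab (f y) \<le> t"
    by metis
  have "inj_on f ?Hlo"
  proof (rule inj_onI)
    fix y y' assume y: "y \<in> ?Hlo" "y' \<in> ?Hlo" "f y = f y'"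
    then have "h y = h y'" "h y \<noteq> 0"
      using f[OF y(1)] f[OF y(2)] by (metis, blast)
    then show "y = y'"
      using mates_inj'[OF h] by simp
  qed
  moreover have "f ` ?Hlo \<subseteq> ?lo"
    using f by force
  ultimately have "card ?Hlo \<le> card ?lo"
    using fin card_inj_on_le by blast
  \<comment> \<open>As \<open>t\<close> is positive, a vertex of label at least \<open>t\<close> is
    covered by \<open>g\<close> because of \<open>free\<close>.\<close>
  moreover have "?H \<subseteq> ?hi \<union> ?Hlo"
    using free t by fastforce
  then have "num_mates h \<le> card (?hi \<union> ?Hlo)"
    unfolding num_mates_def using fin finite_subset[OF _ finite_mates[OF h], of ?Hlo]
    by (intro card_mono) auto
  moreover have "card (?hi \<union> ?Hlo) \<le> card ?hi + card ?Hlo"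
    by (rule card_Un_le)
  \<comment> \<open>The two parts of the cover correspond to sets of edges of \<open>g\<close> that
    overlap exactly in label \<open>t\<close>.\<close>
  moreover have "card ?hi + card ?lo = card (?hi \<union> ?lo) + card (?hi \<inter> ?lo)"
    using fin by (rule card_Un_Int)
  moreover have "?hi \<union> ?lo = ?G" "?hi \<inter> ?lo = {y. g y \<noteq> 0 \<and> lab y = t}"
    by auto
  ultimately show ?thesis
    unfolding num_mates_def by simp
qed

text \<open>Summing over all \<open>t\<close> from 1 to \<open>K\<close>, the surplus terms count
  disjoint label classes and so add up to at most \<open>num_mates g\<close>.\<close>

lemma num_mates_near_maximum:
  assumes g: "mates g" and h: "mates h"
    and free: "\<And>y. g y = 0 \<Longrightarrow> lab y = 0"
    and eq: "\<And>x y. g y = Suc x \<Longrightarrow> lab y = lev x"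
    and slack: "\<And>x y. (x, y) \<in> set es \<Longrightarrow> lev x \<le> Suc (lab y)"
    and dead: "\<And>x y. (x, y) \<in> set es \<Longrightarrow> (\<And>y'. g y' \<noteq> Suc x) \<Longrightarrow> K \<le> lab y"
  shows "K * num_mates h \<le> K * num_mates g + num_mates g"
proof -
  let ?c = "\<lambda>t. {y. g y \<noteq> 0 \<and> lab y = t}"
  have "K * num_mates h = (\<Sum>t\<in>{1..K}. num_mates h)"
    by simp
  also have "\<dots> \<le> (\<Sum>t\<in>{1..K}. num_mates g + card (?c t))"
    using num_mates_le_level[of g h lab lev K] assms by (intro sum_mono) simp
  also have "\<dots> = K * num_mates g + (\<Sum>t\<in>{1..K}. card (?c t))"
    by (simp add: sum.distrib)
  also have "(\<Sum>t\<in>{1..K}. card (?c t)) = card (\<Union>t\<in>{1..K}. ?c t)"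
    by (rule card_UN_disjoint[symmetric])
      (use finite_subset[OF _ finite_mates[OF g]] in auto)
  also have "\<dots> \<le> num_mates g"
    unfolding num_mates_def by (intro card_mono[OF finite_mates[OF g]]) blast
  finally show ?thesis
    by simp
qed


subsection \<open>Linked adjacency lists\<close>

text \<open>An edge pointer \<open>e\<close> in the list of \<open>x\<close> stands for the edges at \<open>x\<close> with index less
  than \<open>e\<close>: the lists run through the edges backwards.\<close>

definition last_edge :: "nat \<Rightarrow> nat \<Rightarrow> nat \<Rightarrow> bool" where
  "last_edge x i e \<longleftrightarrow> e \<le> i \<and> (\<forall>j. e \<le> j \<longrightarrow> j < i \<longrightarrow> src j \<noteq> x) \<and>
     (e \<noteq> 0 \<longrightarrow> src (e - 1) = x)"

definition adjacency :: "(nat \<Rightarrow> nat) \<Rightarrow> (nat \<Rightarrow> nat) \<Rightarrow> bool" where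
  "adjacency first nxt \<longleftrightarrow> (\<forall>x. last_edge x m (first x)) \<and> (\<forall>j<m. last_edge (src j) j (nxt j))"

lemma adjacency_first: "adjacency first nxt \<Longrightarrow> last_edge x m (first x)"
  by (simp add: adjacency_def)

lemma adjacency_next: "adjacency first nxt \<Longrightarrow> j < m \<Longrightarrow> last_edge (src j) j (nxt j)"
  by (simp add: adjacency_def)

lemma last_edge_first:
  "last_edge x m e \<Longrightarrow> j < m \<Longrightarrow> src j = x \<Longrightarrow> j < e"
  by (meson last_edge_def not_le)

text \<open>Advancing the pointer from \<open>Suc j\<close> to \<open>nxt j\<close> takes exactly
  the edge \<open>j\<close> off the edges still ahead.\<close>

lemma last_edge_next:
  "last_edge (src j) j e \<Longrightarrow> src i = src j \<Longrightarrow> i < e \<longleftrightarrow> i < Suc j \<and> i \<noteq> j"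
  by (metis last_edge_def less_Suc_eq less_le_trans not_le)


subsection \<open>The auction\<close>

text \<open>The active vertex, \<open>act - 1\<close>, looks for a neighbour with label below its
  own level, takes it over and raises the label to its level; the evicted partner becomes active.
  Edges with index at least \<open>ptr x\<close> have been scanned at the current level, so their
  targets have reached that level. A vertex that has once been active, or is the source of one of
  the first \<open>k\<close> edges, is matched, active or has given up at level
  \<open>K\<close>.\<close>

definition auction_inv ::
  "nat \<Rightarrow> nat \<Rightarrow> nat \<Rightarrow> (nat \<Rightarrow> nat) \<Rightarrow> (nat \<Rightarrow> nat) \<Rightarrow> (nat \<Rightarrow> nat) \<Rightarrow> (nat \<Rightarrow> nat) \<Rightarrow> bool" where
  "auction_inv K k act ptr lev lab g \<longleftrightarrow>
     k \<le> m \<and> mates g \<and> (\<forall>x. lev x \<le> K) \<and>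
     (\<forall>x. ptr x \<le> m \<and> (ptr x \<noteq> 0 \<longrightarrow> src (ptr x - 1) = x)) \<and>
     (\<forall>y. g y = 0 \<longrightarrow> lab y = 0) \<and>
     (\<forall>x y. g y = Suc x \<longrightarrow> lab y = lev x \<and> 0 < lev x \<and> act \<noteq> Suc x) \<and>
     (\<forall>j<m. lev (src j) \<le> Suc (lab (tgt j)) \<and>
        (ptr (src j) \<le> j \<longrightarrow> lev (src j) \<le> lab (tgt j))) \<and>
     (\<forall>x. 0 < lev x \<or> x \<in> (\<lambda>j. src j) ` {..<k} \<longrightarrow>
        (\<exists>y. g y = Suc x) \<or> act = Suc x \<or> lev x = K \<and> ptr x = 0) \<and>
     (act \<noteq> 0 \<longrightarrow> act - 1 \<in> srcs)"

text \<open>The first sum counts the scans of edges still possible, including those of the current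
  pass; the second counts the raises of levels. An edge awaiting selection weighs 2 because its
  selection may set the last summand, which in turn pays for giving up the active vertex.\<close>

definition auction_potential ::
  "nat \<Rightarrow> nat \<Rightarrow> nat \<Rightarrow> (nat \<Rightarrow> nat) \<Rightarrow> (nat \<Rightarrow> nat) \<Rightarrow> nat" where
  "auction_potential K k act ptr lev =
     (\<Sum>j<m. K - lev (src j) + of_bool (j < ptr (src j))) + (\<Sum>x\<in>srcs. K - lev x) +
     2 * (m - k) + of_bool (act \<noteq> 0)"

lemma auction_inv_init: "auction_inv K 0 0 (\<lambda>_. 0) (\<lambda>_. 0) (\<lambda>_. 0) (\<lambda>_. 0)"
  by (simp add: auction_inv_def mates_zero)

lemma auction_potential_init: "auction_potential K 0 0 (\<lambda>_. 0) (\<lambda>_. 0) \<le> 2 * (m * K) + 2 * m"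
  using card_srcs mult_le_mono1 by (fastforce simp: auction_potential_def)

lemma auction_invI:
  assumes "k \<le> m" "mates g" "\<And>x. lev x \<le> K"
    and "\<And>x. ptr x \<le> m \<and> (ptr x \<noteq> 0 \<longrightarrow> src (ptr x - 1) = x)"
    and "\<And>y. g y = 0 \<Longrightarrow> lab y = 0"
    and "\<And>x y. g y = Suc x \<Longrightarrow> lab y = lev x \<and> 0 < lev x \<and> act \<noteq> Suc x"
    and "\<And>j. j < m \<Longrightarrow> lev (src j) \<le> Suc (lab (tgt j)) \<and>
        (ptr (src j) \<le> j \<longrightarrow> lev (src j) \<le> lab (tgt j))"
    and "\<And>x. 0 < lev x \<or> x \<in> (\<lambda>j. src j) ` {..<k} \<Longrightarrow>
        (\<exists>y. g y = Suc x) \<or> act = Suc x \<or> lev x = K \<and> ptr x = 0"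
    and "act \<noteq> 0 \<Longrightarrow> act - 1 \<in> srcs"
  shows "auction_inv K k act ptr lev lab g"
  using assms unfolding auction_inv_def by atomize (intro conjI; (assumption | iprover))

lemma auction_invD:
  assumes "auction_inv K k act ptr lev lab g"
  shows "k \<le> m" "mates g" "\<And>x. lev x \<le> K"
    and "\<And>x. ptr x \<le> m \<and> (ptr x \<noteq> 0 \<longrightarrow> src (ptr x - 1) = x)"
    and "\<And>y. g y = 0 \<Longrightarrow> lab y = 0"
    and "\<And>x y. g y = Suc x \<Longrightarrow> lab y = lev x \<and> 0 < lev x \<and> act \<noteq> Suc x"
    and "\<And>j. j < m \<Longrightarrow> lev (src j) \<le> Suc (lab (tgt j)) \<and>
        (ptr (src j) \<le> j \<longrightarrow> lev (src j) \<le> lab (tgt j))"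
    and "\<And>x. 0 < lev x \<or> x \<in> (\<lambda>j. src j) ` {..<k} \<Longrightarrow>
        (\<exists>y. g y = Suc x) \<or> act = Suc x \<or> lev x = K \<and> ptr x = 0"
    and "act \<noteq> 0 \<Longrightarrow> act - 1 \<in> srcs"
  using assms unfolding auction_inv_def by iprover+

lemma auction_activate:
  assumes inv: "auction_inv K k 0 ptr lev lab g" and k: "k < m" "lev (src k) = 0"
  shows "auction_inv K (Suc k) (Suc (src k)) ptr lev lab g" (is ?inv)
    "auction_potential K (Suc k) (Suc (src k)) ptr lev < auction_potential K k 0 ptr lev" (is ?pot)
proof -
  show ?inv
  proof (rule auction_invI)
    show "lab y = lev x \<and> 0 < lev x \<and> Suc (src k) \<noteq> Suc x" if "g y = Suc x" for x y
      using auction_invD(6)[OF inv that] k by auto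
    show "(\<exists>y. g y = Suc x) \<or> Suc (src k) = Suc x \<or> lev x = K \<and> ptr x = 0"
      if "0 < lev x \<or> x \<in> (\<lambda>j. src j) ` {..<Suc k}" for x
      using that auction_invD(8)[OF inv, of x] by (auto simp: lessThan_Suc)
  qed (use k auction_invD(2-5,7)[OF inv] in auto)
  show ?pot
    using k by (simp add: auction_potential_def)
qed

lemma auction_skip:
  assumes inv: "auction_inv K k 0 ptr lev lab g" and k: "k < m" "lev (src k) \<noteq> 0"
  shows "auction_inv K (Suc k) 0 ptr lev lab g" (is ?inv)
    "auction_potential K (Suc k) 0 ptr lev < auction_potential K k 0 ptr lev" (is ?pot)
proof -
  show ?inv
  proof (rule auction_invI)
    show "(\<exists>y. g y = Suc x) \<or> 0 = Suc x \<or> lev x = K \<and> ptr x = 0"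
      if "0 < lev x \<or> x \<in> (\<lambda>j. src j) ` {..<Suc k}" for x
      using that k auction_invD(8)[OF inv, of x] by (auto simp: lessThan_Suc)
  qed (use k auction_invD(2-7)[OF inv] in auto)
  show ?pot
    using k by (simp add: auction_potential_def)
qed

text \<open>With the list exhausted at level \<open>K\<close>, all neighbours have label at least
  \<open>K\<close>. Labels never decrease, so this persists and later supplies the condition
  \<open>dead\<close> of the cover argument.\<close>

lemma auction_retire:
  assumes inv: "auction_inv K k (Suc x) ptr lev lab g" and x: "ptr x = 0" "\<not> lev x < K"
  shows "auction_inv K k 0 ptr lev lab g"
    "auction_potential K k 0 ptr lev < auction_potential K k (Suc x) ptr lev"
proof -
  have "lev x = K"
    using x auction_invD(3)[OF inv] by (meson le_antisym not_le)
  then show "auction_inv K k 0 ptr lev lab g"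
  proof (intro auction_invI)
    show "(\<exists>y. g y = Suc z) \<or> 0 = Suc z \<or> lev z = K \<and> ptr z = 0"
      if "0 < lev z \<or> z \<in> (\<lambda>j. src j) ` {..<k}" for z
      using x \<open>lev x = K\<close> auction_invD(8)[OF inv that] by auto
  qed (use auction_invD(1-7)[OF inv] in auto)
qed (simp add: auction_potential_def)

text \<open>An exhausted list means that all neighbours have label at least \<open>lev x\<close>,
  which leaves room for one more level. Restarting the list adds one to each edge term at
  \<open>x\<close>, exactly what the higher level takes away, so the decrease comes from the sum
  over the vertices.\<close>

lemma auction_raise:
  assumes adj: "adjacency first nxt"
    and inv: "auction_inv K k (Suc x) ptr lev lab g" and x: "ptr x = 0" "lev x < K"
  shows "auction_inv K k (Suc x) (ptr(x := first x)) (lev(x := Suc (lev x))) lab g" (is ?inv)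
    and "auction_potential K k (Suc x) (ptr(x := first x)) (lev(x := Suc (lev x)))
      < auction_potential K k (Suc x) ptr lev" (is ?pot)
proof -
  note first = adjacency_first[OF adj, of x]
  have lab: "lev x \<le> lab (tgt j)" if "j < m" "src j = x" for j
    using inv x that by (auto simp: auction_inv_def)
  have unmatched: "g y \<noteq> Suc x" for y
    using auction_invD(6)[OF inv] by blast
  show ?inv
  proof (rule auction_invI)
    show "(lev(x := Suc (lev x))) (src j) \<le> Suc (lab (tgt j)) \<and> ((ptr(x := first x)) (src j) \<le> j \<longrightarrow>
        (lev(x := Suc (lev x))) (src j) \<le> lab (tgt j))" if "j < m" for j
      using that lab auction_invD(7)[OF inv that] last_edge_first[OF first that] by auto
    show "(\<exists>y. g y = Suc z) \<or> Suc x = Suc z \<or>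
        (lev(x := Suc (lev x))) z = K \<and> (ptr(x := first x)) z = 0"
      if "0 < (lev(x := Suc (lev x))) z \<or> z \<in> (\<lambda>j. src j) ` {..<k}" for z
      using that auction_invD(8)[OF inv, of z] by (cases "z = x") auto
  qed (use auction_invD(1-6,9)[OF inv] unmatched x first in \<open>auto simp: last_edge_def\<close>)
  have "(\<Sum>j<m. K - (lev(x := Suc (lev x))) (src j) + of_bool (j < (ptr(x := first x)) (src j)))
      = (\<Sum>j<m. K - lev (src j) + of_bool (j < ptr (src j)))"
    using x last_edge_first[OF first] by (intro sum.cong) auto
  moreover have "x \<in> srcs"
    using inv by (auto simp: auction_inv_def)
  then have "(\<Sum>z\<in>srcs. K - (lev(x := Suc (lev x))) z) < (\<Sum>z\<in>srcs. K - lev z)"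
    using x by (intro sum_strict_mono_ex1) auto
  ultimately show ?pot
    by (simp add: auction_potential_def)
qed

lemma auction_scan_potential:
  assumes adj: "adjacency first nxt" and j: "ptr x = Suc j" "j < m" "src j = x"
  shows "(\<Sum>i<m. K - lev (src i) + of_bool (i < (ptr(x := nxt j)) (src i))) <
    (\<Sum>i<m. K - lev (src i) + (of_bool (i < ptr (src i)) :: nat))"
proof (intro sum_strict_mono_ex1 ballI)
  note nxt = adjacency_next[OF adj j(2)]
  show "K - lev (src i) + of_bool (i < (ptr(x := nxt j)) (src i))
      \<le> K - lev (src i) + of_bool (i < ptr (src i))" for i
    using last_edge_next[OF nxt, of i] j by auto
  show "\<exists>i\<in>{..<m}. K - lev (src i) + of_bool (i < (ptr(x := nxt j)) (src i))
      < K - lev (src i) + of_bool (i < ptr (src i))"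
    using last_edge_next[OF nxt, of j] j by (intro bexI[of _ j]) auto
qed simp

lemma auction_pointer:
  assumes "auction_inv K k (Suc x) ptr lev lab g" "ptr x \<noteq> 0"
  obtains j where "ptr x = Suc j" "j < m" "src j = x"
  using assms by (cases "ptr x") (auto simp: auction_inv_def Suc_le_eq dest: spec[of _ x])

lemma auction_reject:
  assumes adj: "adjacency first nxt" and inv: "auction_inv K k (Suc x) ptr lev lab g"
    and j: "ptr x = Suc j" and lab: "\<not> lab (tgt j) < lev x"
  shows "auction_inv K k (Suc x) (ptr(x := nxt j)) lev lab g" (is ?inv)
    "auction_potential K k (Suc x) (ptr(x := nxt j)) lev < auction_potential K k (Suc x) ptr lev" (is ?pot)
proof -
  have jm: "j < m" "src j = x"
    using auction_pointer[OF inv] j by auto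
  note nxt = adjacency_next[OF adj jm(1)]
  have le: "lev x \<le> lab (tgt i)" if "i < m" "src i = x" "nxt j \<le> i" for i
    using that inv last_edge_next[OF nxt, of i] jm j lab
    by (cases "i = j") (auto simp: auction_inv_def)
  show ?inv
  proof (rule auction_invI)
    show "lev (src i) \<le> Suc (lab (tgt i)) \<and> ((ptr(x := nxt j)) (src i) \<le> i \<longrightarrow>
        lev (src i) \<le> lab (tgt i))" if "i < m" for i
      using that le auction_invD(7)[OF inv that] by auto
    show "(\<exists>y. g y = Suc z) \<or> Suc x = Suc z \<or> lev z = K \<and> (ptr(x := nxt j)) z = 0"
      if "0 < lev z \<or> z \<in> (\<lambda>j. src j) ` {..<k}" for z
      using auction_invD(8)[OF inv that] by (cases "z = x") auto
  qed (use auction_invD(1-6,9)[OF inv] nxt jm in \<open>auto simp: last_edge_def\<close>)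
  show ?pot
    using auction_scan_potential[OF adj, of ptr x j K lev] j jm by (simp add: auction_potential_def)
qed

text \<open>The entry \<open>g (tgt j)\<close> is already in the format of \<open>act\<close>: the
  evicted partner plus one, or 0 if the vertex was free. The label only grows, which preserves the
  inequalities at the other edges.\<close>

lemma auction_match:
  assumes adj: "adjacency first nxt" and inv: "auction_inv K k (Suc x) ptr lev lab g"
    and j: "ptr x = Suc j" and lab: "lab (tgt j) < lev x"
  shows "auction_inv K k (g (tgt j)) (ptr(x := nxt j)) lev (lab(tgt j := lev x)) (g(tgt j := Suc x))"
      (is ?inv)
    "auction_potential K k (g (tgt j)) (ptr(x := nxt j)) lev < auction_potential K k (Suc x) ptr lev"
      (is ?pot)
proof -
  let ?y = "tgt j" and ?lab = "lab(tgt j := lev x)"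
  have jm: "j < m" "src j = x"
    using auction_pointer[OF inv] j by auto
  note nxt = adjacency_next[OF adj jm(1)] and g = auction_invD(2)[OF inv]
  have unmatched: "g y \<noteq> Suc x" for y
    using auction_invD(6)[OF inv] by blast
  have le: "lev x \<le> ?lab (tgt i)" if "i < m" "src i = x" "nxt j \<le> i" for i
    using auction_invD(7)[OF inv that(1)] that last_edge_next[OF nxt, of i] jm j lab
    by (cases "i = j") auto
  show ?inv
  proof (rule auction_invI)
    show "mates (g(?y := Suc x))"
      using mates_update[OF g _ unmatched] edge_nth[OF jm(1)] jm by simp
    show "(ptr(x := nxt j)) z \<le> m \<and> ((ptr(x := nxt j)) z \<noteq> 0 \<longrightarrow> src ((ptr(x := nxt j)) z - 1) = z)"
      for z
      using auction_invD(4)[OF inv, of z] nxt jm by (auto simp: last_edge_def)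
    show "?lab y = 0" if "(g(?y := Suc x)) y = 0" for y
      using that auction_invD(5)[OF inv, of y] by (auto split: if_splits)
    show "?lab y = lev z \<and> 0 < lev z \<and> g ?y \<noteq> Suc z" if "(g(?y := Suc x)) y = Suc z" for y z
    proof (cases "y = ?y")
      case True
      then show ?thesis
        using that lab unmatched by auto
    next
      case False
      then show ?thesis
        using that auction_invD(6)[OF inv, of y z] mates_inj[OF g, of ?y z y] by auto
    qed
    show "lev (src i) \<le> Suc (?lab (tgt i)) \<and>
        ((ptr(x := nxt j)) (src i) \<le> i \<longrightarrow> lev (src i) \<le> ?lab (tgt i))" if "i < m" for i
      using that le[OF that] auction_invD(7)[OF inv that] lab by auto
    show "(\<exists>y. (g(?y := Suc x)) y = Suc z) \<or> g ?y = Suc z \<or> lev z = K \<and> (ptr(x := nxt j)) z = 0"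
      if "0 < lev z \<or> z \<in> (\<lambda>j. src j) ` {..<k}" for z
    proof (cases "z = x")
      case True
      then show ?thesis
        by auto
    next
      case False
      then have "(\<exists>y. g y = Suc z) \<or> lev z = K \<and> ptr z = 0"
        using auction_invD(8)[OF inv that] by simp
      then show ?thesis
        using False by (metis fun_upd_apply)
    qed
    show "g ?y - 1 \<in> srcs" if "g ?y \<noteq> 0"
      using edge_src[OF mates_edge'[OF g that]] .
  qed (use auction_invD(1,3)[OF inv] in auto)
  show ?pot
    using auction_scan_potential[OF adj, of ptr x j K lev] j jm by (simp add: auction_potential_def)
qed

text \<open>All sources have been selected and none is active, so the unmatched ones have given
  up.\<close>

lemma auction_final:
  assumes inv: "auction_inv K m 0 ptr lev lab g" and h: "mates h"
  shows "K * num_mates h \<le> K * num_mates g + num_mates g"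
proof (rule num_mates_near_maximum[of g h lab lev])
  fix x y assume xy: "(x, y) \<in> set es"
  then obtain j where j: "j < m" "src j = x" "tgt j = y"
    by (rule edge_cases)
  then show "lev x \<le> Suc (lab y)"
    using inv by (auto simp: auction_inv_def)
  assume "\<And>y'. g y' \<noteq> Suc x"
  then have "lev x = K \<and> ptr x = 0"
    using auction_invD(8)[OF inv, of x] j by auto
  then show "K \<le> lab y"
    using inv j by (auto simp: auction_inv_def)
qed (use inv h in \<open>auto simp: auction_inv_def\<close>)


subsection \<open>The search for an augmenting path\<close>

text \<open>Breadth-first search from the unmatched sources. The vertices \<open>Q 0\<close>, ...,
  \<open>Q (tail - 1)\<close> are reached, those before \<open>head\<close> are dequeued, and the
  last dequeued one, \<open>x\<close>, is scanned with edge pointer \<open>e\<close>.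
  \<open>par\<close> holds the vertex from which a vertex of \<open>Y\<close> was reached. That the
  parent of a partner stands strictly earlier in the queue makes the later walk along the parents
  terminate.\<close>

definition search_inv ::
  "(nat \<Rightarrow> nat) \<Rightarrow> (nat \<Rightarrow> nat) \<Rightarrow> nat \<Rightarrow> nat \<Rightarrow> nat \<Rightarrow> nat \<Rightarrow> (nat \<Rightarrow> nat) \<Rightarrow> (nat \<Rightarrow> nat) \<Rightarrow> nat \<Rightarrow> bool"
where
  "search_inv g Q tail head x e par unre found \<longleftrightarrow>
     head \<le> tail \<and> inj_on Q {..<tail} \<and> (\<forall>i. i < tail \<longrightarrow> Q i \<in> srcs) \<and>
     (\<forall>z. unre z \<noteq> 0 \<longleftrightarrow> z \<in> srcs \<and> z \<notin> Q ` {..<tail}) \<and>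
     (\<forall>z. z \<in> srcs \<longrightarrow> (\<forall>y. g y \<noteq> Suc z) \<longrightarrow> z \<in> Q ` {..<tail}) \<and>
     (\<forall>i y. i < tail \<longrightarrow> g y = Suc (Q i) \<longrightarrow> (\<exists>l<i. par y = Suc (Q l))) \<and>
     (\<forall>y. par y \<noteq> 0 \<longrightarrow> (\<exists>l<head. par y = Suc (Q l) \<and> (Q l, y) \<in> set es)) \<and>
     (\<forall>y z. par y \<noteq> 0 \<longrightarrow> g y = Suc z \<longrightarrow> z \<in> Q ` {..<tail}) \<and>
     (\<forall>i j. i < head \<longrightarrow> j < m \<longrightarrow> src j = Q i \<longrightarrow> par (tgt j) \<noteq> 0 \<or> i = head - 1 \<and> j < e) \<and>
     (e \<noteq> 0 \<longrightarrow> 0 < head \<and> x = Q (head - 1) \<and> src (e - 1) = x) \<and> e \<le> m \<and>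
     (\<forall>y. found = 0 \<longrightarrow> par y \<noteq> 0 \<longrightarrow> g y \<noteq> 0) \<and>
     (found \<noteq> 0 \<longrightarrow> par (found - 1) \<noteq> 0 \<and> g (found - 1) = 0)"

lemma search_invI:
  assumes "head \<le> tail" "inj_on Q {..<tail}" "\<And>i. i < tail \<Longrightarrow> Q i \<in> srcs"
    and "\<And>z. unre z \<noteq> 0 \<longleftrightarrow> z \<in> srcs \<and> z \<notin> Q ` {..<tail}"
    and "\<And>z. z \<in> srcs \<Longrightarrow> (\<forall>y. g y \<noteq> Suc z) \<Longrightarrow> z \<in> Q ` {..<tail}"
    and "\<And>i y. i < tail \<Longrightarrow> g y = Suc (Q i) \<Longrightarrow> \<exists>l<i. par y = Suc (Q l)"
    and "\<And>y. par y \<noteq> 0 \<Longrightarrow> \<exists>l<head. par y = Suc (Q l) \<and> (Q l, y) \<in> set es"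
    and "\<And>y z. par y \<noteq> 0 \<Longrightarrow> g y = Suc z \<Longrightarrow> z \<in> Q ` {..<tail}"
    and "\<And>i j. i < head \<Longrightarrow> j < m \<Longrightarrow> src j = Q i \<Longrightarrow> par (tgt j) \<noteq> 0 \<or> i = head - 1 \<and> j < e"
    and "e \<noteq> 0 \<Longrightarrow> 0 < head \<and> x = Q (head - 1) \<and> src (e - 1) = x" and "e \<le> m"
    and "\<And>y. found = 0 \<Longrightarrow> par y \<noteq> 0 \<Longrightarrow> g y \<noteq> 0"
    and "found \<noteq> 0 \<Longrightarrow> par (found - 1) \<noteq> 0 \<and> g (found - 1) = 0"
  shows "search_inv g Q tail head x e par unre found"
  using assms unfolding search_inv_def by atomize (intro conjI; assumption)

lemma search_invD:
  assumes "search_inv g Q tail head x e par unre found"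
  shows "head \<le> tail" "inj_on Q {..<tail}" "\<And>i. i < tail \<Longrightarrow> Q i \<in> srcs"
    and "\<And>z. unre z \<noteq> 0 \<longleftrightarrow> z \<in> srcs \<and> z \<notin> Q ` {..<tail}"
    and "\<And>z. z \<in> srcs \<Longrightarrow> (\<And>y. g y \<noteq> Suc z) \<Longrightarrow> z \<in> Q ` {..<tail}"
    and "\<And>i y. i < tail \<Longrightarrow> g y = Suc (Q i) \<Longrightarrow> \<exists>l<i. par y = Suc (Q l)"
    and "\<And>y. par y \<noteq> 0 \<Longrightarrow> \<exists>l<head. par y = Suc (Q l) \<and> (Q l, y) \<in> set es"
    and "\<And>y z. par y \<noteq> 0 \<Longrightarrow> g y = Suc z \<Longrightarrow> z \<in> Q ` {..<tail}"
    and "\<And>i j. i < head \<Longrightarrow> j < m \<Longrightarrow> src j = Q i \<Longrightarrow> par (tgt j) \<noteq> 0 \<or> i = head - 1 \<and> j < e"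
    and "e \<noteq> 0 \<Longrightarrow> 0 < head \<and> x = Q (head - 1) \<and> src (e - 1) = x" and "e \<le> m"
    and "\<And>y. found = 0 \<Longrightarrow> par y \<noteq> 0 \<Longrightarrow> g y \<noteq> 0"
    and "found \<noteq> 0 \<Longrightarrow> par (found - 1) \<noteq> 0 \<and> g (found - 1) = 0"
  using assms unfolding search_inv_def by simp_all

definition unscanned :: "(nat \<Rightarrow> nat) \<Rightarrow> nat \<Rightarrow> nat \<Rightarrow> nat set" where
  "unscanned Q head e =
     {j. j < m \<and> (src j \<notin> Q ` {..<head} \<or> src j = Q (head - 1) \<and> j < e)}"

text \<open>Dequeuing lowers the first summand and keeps the second; scanning an edge lowers the
  second.\<close>

definition search_potential :: "(nat \<Rightarrow> nat) \<Rightarrow> nat \<Rightarrow> nat \<Rightarrow> nat" where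
  "search_potential Q head e = m - head + card (unscanned Q head e)"

lemma finite_unscanned [simp]: "finite (unscanned Q head e)"
  by (simp add: unscanned_def)

lemma search_potential_init: "search_potential Q 0 0 \<le> 2 * m"
proof -
  have "card (unscanned Q 0 0) \<le> card {..<m}"
    by (intro card_mono) (auto simp: unscanned_def)
  then show ?thesis
    by (simp add: search_potential_def)
qed

lemma search_tail_le:
  assumes "inj_on Q {..<tail}" "\<And>i. i < tail \<Longrightarrow> Q i \<in> srcs"
  shows "tail \<le> m"
proof -
  have "card {..<tail} \<le> card srcs"
    using assms by (intro card_inj_on_le[of Q]) auto
  then show ?thesis
    using card_srcs by simp
qed

lemma search_dequeue:
  assumes adj: "adjacency first nxt" and inv: "search_inv g Q tail head x 0 par unre 0"
    and head: "head < tail"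
  shows "search_inv g Q tail (Suc head) (Q head) (first (Q head)) par unre 0" (is ?inv)
    "search_potential Q (Suc head) (first (Q head)) < search_potential Q head 0" (is ?pot)
proof -
  note first = adjacency_first[OF adj, of "Q head"]
  show ?inv
  proof (rule search_invI)
    show "\<exists>l<Suc head. par y = Suc (Q l) \<and> (Q l, y) \<in> set es" if "par y \<noteq> 0" for y
      using search_invD(7)[OF inv that] less_SucI by blast
    show "par (tgt j) \<noteq> 0 \<or> i = Suc head - 1 \<and> j < first (Q head)"
      if "i < Suc head" "j < m" "src j = Q i" for i j
      using search_invD(9)[OF inv, of i j] that last_edge_first[OF first, of j]
      by (cases "i = head") auto
    show "0 < Suc head \<and> Q head = Q (Suc head - 1) \<and> src (first (Q head) - 1) = Q head"
      if "first (Q head) \<noteq> 0"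
      using first that by (simp add: last_edge_def)
    show "first (Q head) \<le> m"
      using first by (simp add: last_edge_def)
  qed (use head search_invD[OF inv] in \<open>simp_all only: Suc_le_eq simp_thms\<close>)
  \<comment> \<open>The edges at \<open>Q head\<close> change from those of a vertex not dequeued to
    those ahead of the pointer, since \<open>first\<close> lies beyond all of them.\<close>
  have "unscanned Q (Suc head) (first (Q head)) = unscanned Q head 0"
  proof -
    have "Q i \<noteq> Q head" if "i < head" for i
      using inj_onD[OF search_invD(2)[OF inv], of i head] head that by auto
    then show ?thesis
      using last_edge_first[OF first] by (force simp: unscanned_def lessThan_Suc)
  qed
  moreover have "tail \<le> m"
    using search_tail_le search_invD(2,3)[OF inv] by blast
  ultimately show ?pot
    using head by (simp add: search_potential_def)
qed

lemma search_pointer: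
  assumes inv: "search_inv g Q tail head x (Suc j) par unre found"
  shows "0 < head" "x = Q (head - 1)" "src j = x" "j < m"
  using search_invD(10,11)[OF inv] by auto

lemma search_scan_potential:
  assumes adj: "adjacency first nxt" and inv: "search_inv g Q tail head x (Suc j) par unre found"
  shows "search_potential Q head (nxt j) < search_potential Q head (Suc j)"
proof -
  note ptr = search_pointer[OF inv]
  note nxt = adjacency_next[OF adj ptr(4)]
  have "j \<notin> unscanned Q head (nxt j)" "j \<in> unscanned Q head (Suc j)"
    using ptr last_edge_next[OF nxt, of j] by (auto simp: unscanned_def)
  moreover have "unscanned Q head (nxt j) \<subseteq> unscanned Q head (Suc j)"
    using ptr last_edge_next[OF nxt] by (auto simp: unscanned_def)
  ultimately have "unscanned Q head (nxt j) \<subset> unscanned Q head (Suc j)"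
    by blast
  then show ?thesis
    using psubset_card_mono[OF finite_unscanned] by (simp add: search_potential_def)
qed

lemma search_scan:
  assumes adj: "adjacency first nxt" and inv: "search_inv g Q tail head x (Suc j) par unre found"
  shows "nxt j \<noteq> 0 \<Longrightarrow> 0 < head \<and> x = Q (head - 1) \<and> src (nxt j - 1) = x" and "nxt j \<le> m"
    and "i < head \<Longrightarrow> k < m \<Longrightarrow> src k = Q i \<Longrightarrow> k \<noteq> j \<Longrightarrow> par (tgt k) \<noteq> 0 \<or> i = head - 1 \<and> k < nxt j"
proof -
  note ptr = search_pointer[OF inv]
  note nxt = adjacency_next[OF adj ptr(4)]
  show "0 < head \<and> x = Q (head - 1) \<and> src (nxt j - 1) = x" if "nxt j \<noteq> 0"
    using nxt ptr that by (simp add: last_edge_def)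
  show "nxt j \<le> m"
    using nxt ptr(4) by (simp add: last_edge_def)
  show "par (tgt k) \<noteq> 0 \<or> i = head - 1 \<and> k < nxt j"
    if "i < head" "k < m" "src k = Q i" "k \<noteq> j"
    using search_invD(9)[OF inv that(1-3)] last_edge_next[OF nxt, of k] that ptr by auto
qed

lemma search_visited:
  assumes adj: "adjacency first nxt" and inv: "search_inv g Q tail head x (Suc j) par unre 0"
    and visited: "par (tgt j) \<noteq> 0"
  shows "search_inv g Q tail head x (nxt j) par unre 0"
proof (rule search_invI)
  show "par (tgt k) \<noteq> 0 \<or> i = head - 1 \<and> k < nxt j" if "i < head" "k < m" "src k = Q i" for i k
    using search_scan(3)[OF adj inv that] visited by (cases "k = j") simp_all
qed (use search_invD(1-8,12-13)[OF inv] search_scan(1,2)[OF adj inv] in \<open>simp_all only: simp_thms\<close>)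

text \<open>The new parent is the vertex being scanned. Partners of enqueued vertices already have a
  parent, so the overwritten entry is not one of theirs.\<close>

lemma search_parent:
  assumes inv: "search_inv g Q tail head x (Suc j) par unre found" and new: "par (tgt j) = 0"
  shows "(par(tgt j := Suc x)) y \<noteq> 0 \<Longrightarrow>
      \<exists>l<head. (par(tgt j := Suc x)) y = Suc (Q l) \<and> (Q l, y) \<in> set es"
    and "i < tail \<Longrightarrow> g y = Suc (Q i) \<Longrightarrow> \<exists>l<i. (par(tgt j := Suc x)) y = Suc (Q l)"
proof -
  note ptr = search_pointer[OF inv]
  show "\<exists>l<head. (par(tgt j := Suc x)) y = Suc (Q l) \<and> (Q l, y) \<in> set es"
    if "(par(tgt j := Suc x)) y \<noteq> 0"
  proof (cases "y = tgt j")
    case True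
    then show ?thesis
      using ptr edge_nth[OF ptr(4)] by (intro exI[of _ "head - 1"]) auto
  next
    case False
    then show ?thesis
      using search_invD(7)[OF inv, of y] that by simp
  qed
  show "\<exists>l<i. (par(tgt j := Suc x)) y = Suc (Q l)" if "i < tail" "g y = Suc (Q i)"
    using search_invD(6)[OF inv that] new by auto
qed

lemma search_found:
  assumes adj: "adjacency first nxt" and inv: "search_inv g Q tail head x (Suc j) par unre 0"
    and new: "par (tgt j) = 0" and free: "g (tgt j) = 0"
  shows "search_inv g Q tail head x (nxt j) (par(tgt j := Suc x)) unre (Suc (tgt j))"
proof (rule search_invI)
  show "(par(tgt j := Suc x)) (tgt k) \<noteq> 0 \<or> i = head - 1 \<and> k < nxt j"
    if "i < head" "k < m" "src k = Q i" for i k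
    using search_scan(3)[OF adj inv that] by (cases "k = j") auto
  show "z \<in> Q ` {..<tail}" if "(par(tgt j := Suc x)) y \<noteq> 0" "g y = Suc z" for y z
    using search_invD(8)[OF inv, of y z] that free by (cases "y = tgt j") auto
qed (use search_invD(1-5)[OF inv] search_scan(1,2)[OF adj inv] search_parent[OF inv new] free in auto)

lemma inj_on_enqueue:
  assumes "inj_on Q {..<t}" "x \<notin> Q ` {..<t :: nat}"
  shows "inj_on (Q(t := x)) {..<Suc t}"
proof -
  have "inj_on (Q(t := x)) {..<t}"
    using assms by (rule inj_on_fun_updI)
  moreover have "(Q(t := x)) ` {..<t} = Q ` {..<t}"
    by (intro image_cong) auto
  ultimately show ?thesis
    using assms(2) by (simp add: lessThan_Suc)
qed

lemma search_enqueue: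
  assumes adj: "adjacency first nxt" and g: "mates g"
    and inv: "search_inv g Q tail head x (Suc j) par unre 0"
    and new: "par (tgt j) = 0" and mate: "g (tgt j) = Suc x'"
  shows "search_inv g (Q(tail := x')) (Suc tail) head x (nxt j) (par(tgt j := Suc x)) (unre(x' := 0)) 0"
      (is ?inv)
    "search_potential (Q(tail := x')) head (nxt j) < search_potential Q head (Suc j)" (is ?pot)
proof -
  let ?Q = "Q(tail := x')" and ?par = "par(tgt j := Suc x)"
  note ptr = search_pointer[OF inv]
  have ht: "head \<le> tail"
    using search_invD(1)[OF inv] .
  have x': "x' \<in> srcs"
    using mates_edge[OF g mate] edge_src by blast
  have new': "x' \<notin> Q ` {..<tail}"
  \<comment> \<open>If \<open>x'\<close> were enqueued already, its partner \<open>tgt j\<close>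
    would have a parent.\<close>
  proof
    assume "x' \<in> Q ` {..<tail}"
    then obtain i where "i < tail" "g (tgt j) = Suc (Q i)"
      using mate by auto
    then show False
      using search_invD(6)[OF inv] new by fastforce
  qed
  have Qim: "?Q ` {..<Suc tail} = insert x' (Q ` {..<tail})"
    by (auto simp: lessThan_Suc)
  have Qlt: "?Q i = Q i" if "i < tail" for i
    using that by simp
  have Qhead: "?Q i = Q i" if "i < head" for i
    using that ht by simp
  show ?inv
  proof (rule search_invI)
    show "inj_on ?Q {..<Suc tail}"
      using search_invD(2)[OF inv] new' by (rule inj_on_enqueue)
    show "?Q i \<in> srcs" if "i < Suc tail" for i
      using search_invD(3)[OF inv, of i] that x' by auto
    show "(unre(x' := 0)) z \<noteq> 0 \<longleftrightarrow> z \<in> srcs \<and> z \<notin> ?Q ` {..<Suc tail}" for z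
      unfolding Qim using search_invD(4)[OF inv, of z] by auto
    show "z \<in> ?Q ` {..<Suc tail}" if "z \<in> srcs" "\<forall>y. g y \<noteq> Suc z" for z
      unfolding Qim using search_invD(5)[OF inv that(1)] that(2) by blast
    show "\<exists>l<i. ?par y = Suc (?Q l)" if i: "i < Suc tail" and y: "g y = Suc (?Q i)" for i y
    proof (cases "i = tail")
      case True
      then have "y = tgt j"
        using y mate mates_inj[OF g] by simp
      then show ?thesis
        using True ptr ht Qhead[of "head - 1"] by (intro exI[of _ "head - 1"]) auto
    next
      case False
      then have "i < tail"
        using i by simp
      then obtain l where "l < i" "?par y = Suc (Q l)"
        using search_parent(2)[OF inv new, of i y] y by auto
      then show ?thesis
        using Qlt[of l] \<open>i < tail\<close> by (intro exI[of _ l]) simp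
    qed
    show "\<exists>l<head. ?par y = Suc (?Q l) \<and> (?Q l, y) \<in> set es" if "?par y \<noteq> 0" for y
      using search_parent(1)[OF inv new that] Qhead by metis
    show "z \<in> ?Q ` {..<Suc tail}" if "?par y \<noteq> 0" "g y = Suc z" for y z
      unfolding Qim using search_invD(8)[OF inv, of y z] that mate by (cases "y = tgt j") auto
    show "?par (tgt k) \<noteq> 0 \<or> i = head - 1 \<and> k < nxt j"
      if "i < head" "k < m" "src k = ?Q i" for i k
      using search_scan(3)[OF adj inv that(1,2)] that Qhead[of i] by (cases "k = j") auto
    show "0 < head \<and> x = ?Q (head - 1) \<and> src (nxt j - 1) = x" if "nxt j \<noteq> 0"
      using search_scan(1)[OF adj inv that] Qhead[of "head - 1"] by simp
    show "g y \<noteq> 0" if "?par y \<noteq> 0" for y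
      using search_invD(12)[OF inv, of y] that mate by (cases "y = tgt j") auto
  qed (use ht search_scan(2)[OF adj inv] in auto)
  have "?Q ` {..<head} = Q ` {..<head}"
    using Qhead by (intro image_cong) auto
  then have "unscanned ?Q head (nxt j) = unscanned Q head (nxt j)"
    using Qhead[of "head - 1"] ptr(1) unfolding unscanned_def by simp
  then show ?pot
    using search_scan_potential[OF adj inv] by (simp add: search_potential_def)
qed

section \<open>From an exhausted search to the partition\<close>

definition mate_edges :: "(nat \<Rightarrow> nat) \<Rightarrow> (nat \<times> nat) set" where
  "mate_edges g = {(x, y). g y = Suc x}"

lemma matching_mate_edges:
  assumes "mates g"
  shows "matching (set es) (mate_edges g)"
proof (rule matchingI)
  show "mate_edges g \<subseteq> set es"
    using mates_edge[OF assms] by (auto simp: mate_edges_def)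
  show "y = y'" if "(x, y) \<in> mate_edges g" "(x, y') \<in> mate_edges g" for x y y'
    using that mates_inj[OF assms] by (auto simp: mate_edges_def)
qed (auto simp: mate_edges_def)

text \<open>With the queue exhausted and nothing found, the unmarked vertices are exactly the
  reachable ones and the vertices with a parent are their neighbours. All these neighbours have
  partners, so there is no augmenting path.\<close>

lemma search_closed:
  assumes g: "mates g" and inv: "search_inv g Q tail tail x 0 par unre 0"
  shows "envy_free_partition {..<p} {..<q} (set es)
    {x. x < p \<and> unre x = 0} {x. x < p \<and> unre x \<noteq> 0} {y. y < q \<and> par y \<noteq> 0} {y. y < q \<and> par y = 0}"
proof -
  let ?M = "mate_edges g" and ?R = "alt_reach {..<p} (set es) (mate_edges g)"
  have bip: "bipartite_graph {..<p} {..<q} (set es)"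
    using edges by (simp add: bipartite_graph_def)
  have scanned: "par y \<noteq> 0" if "i < tail" "(Q i, y) \<in> set es" for i y
    using edge_cases[OF that(2)] search_invD(9)[OF inv that(1)] by (metis not_less0)
  have Q: "Q i \<in> ?R" if "i < tail" for i
    using that
  proof (induction i rule: less_induct)
    case (less i)
    show ?case
    proof (cases "\<exists>y. g y = Suc (Q i)")
      case True
      then obtain y l where l: "g y = Suc (Q i)" "l < i" "par y = Suc (Q l)"
        using search_invD(6)[OF inv less.prems] by blast
      then have "(Q l, y) \<in> set es"
        using search_invD(7)[OF inv, of y] by auto
      moreover have "Q l \<in> ?R"
        using less l by simp
      ultimately show ?thesis
        using alt_reach_step[of "Q l" "{..<p}" "set es" ?M y "Q i"] l(1) by (simp add: mate_edges_def)
    next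
      case False
      then have "Q i \<in> {..<p} - Domain ?M"
        using srcs_less search_invD(3)[OF inv less.prems] by (auto simp: mate_edges_def)
      then show ?thesis
        using alt_reach_free[of "{..<p}" ?M "set es"] by (rule rev_subsetD)
    qed
  qed
  have reach: "x < p \<and> unre x = 0" if "x \<in> alt_layer {..<p} (set es) ?M n" for x n
    using that
  proof (induction n arbitrary: x)
    case 0
    then have "x \<in> srcs \<Longrightarrow> x \<in> Q ` {..<tail}"
      using search_invD(5)[OF inv, of x] by (auto simp: mate_edges_def)
    then show ?case
      using 0 search_invD(4)[OF inv, of x] by auto
  next
    case (Suc n)
    then obtain z y where "z \<in> alt_layer {..<p} (set es) ?M n" "(z, y) \<in> set es" "(x, y) \<in> ?M"
      by auto
    then have z: "unre z = 0" "(z, y) \<in> set es" "g y = Suc x"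
      using Suc.IH by (simp_all add: mate_edges_def)
    then have "z \<in> Q ` {..<tail}"
      using search_invD(4)[OF inv, of z] edge_src by blast
    then have "par y \<noteq> 0"
      using scanned z by auto
    then have x: "x \<in> Q ` {..<tail}"
      using search_invD(8)[OF inv _ z(3)] by blast
    then show ?case
      using search_invD(3)[OF inv] search_invD(4)[OF inv, of x] srcs_less by auto
  qed
  have R: "{x. x < p \<and> unre x = 0} = ?R"
  proof (intro equalityI subsetI)
    fix x assume x: "x \<in> {x. x < p \<and> unre x = 0}"
    show "x \<in> ?R"
    proof (cases "x \<in> srcs")
      case True
      then show ?thesis
        using x search_invD(4)[OF inv, of x] Q by auto
    next
      \<comment> \<open>Isolated vertices are uncovered and hence reachable at distance 0, although
        the queue never contains them.\<close>
      case False
      then have "x \<notin> Domain ?M"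
        using mates_edge[OF g] edge_src by (auto simp: mate_edges_def)
      then show ?thesis
        using x alt_reach_free[of "{..<p}" ?M "set es"] by auto
    qed
  qed (use reach in \<open>auto simp: alt_reach_def\<close>)
  have YS: "{y. y < q \<and> par y \<noteq> 0} = set es `` ?R"
  proof (intro equalityI subsetI)
    fix y assume "y \<in> {y. y < q \<and> par y \<noteq> 0}"
    then obtain l where "l < tail" "(Q l, y) \<in> set es"
      using search_invD(7)[OF inv] by auto
    then show "y \<in> set es `` ?R"
      using Q by blast
  next
    fix y assume "y \<in> set es `` ?R"
    then obtain z where z: "unre z = 0" "(z, y) \<in> set es"
      unfolding R[symmetric] by blast
    then have "z \<in> Q ` {..<tail}"
      using search_invD(4)[OF inv, of z] edge_src by blast
    then show "y \<in> {y. y < q \<and> par y \<noteq> 0}"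
      using scanned z tgts_less edge_tgt by auto
  qed
  have "y \<in> Range ?M" if "x \<in> ?R" "(x, y) \<in> set es" for x y
  proof -
    have "par y \<noteq> 0"
      using that YS by blast
    then have "g y \<noteq> 0"
      using search_invD(12)[OF inv] by blast
    then obtain z where "g y = Suc z"
      using not0_implies_Suc by blast
    then show ?thesis
      by (auto simp: mate_edges_def)
  qed
  from envy_free_partition_alt_reach[OF bip matching_mate_edges[OF g] this]
  have "envy_free_partition {..<p} {..<q} (set es) ?R ({..<p} - ?R)
    (set es `` ?R) ({..<q} - set es `` ?R)" .
  moreover have "{x. x < p \<and> unre x \<noteq> 0} = {..<p} - ?R"
    unfolding R[symmetric] by auto
  moreover have "{y. y < q \<and> par y = 0} = {..<q} - set es `` ?R"
    unfolding YS[symmetric] by auto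
  ultimately show ?thesis
    unfolding R YS by simp
qed


subsection \<open>Augmentation along the parent pointers\<close>

text \<open>While the path is being flipped, the entry of the vertex \<open>y\<close> to be rematched next is stale;
  without it the array is a matching that agrees with the initial one on the rest of the path,
  the part before position \<open>l\<close> of the queue.\<close>

definition augment_inv ::
  "(nat \<Rightarrow> nat) \<Rightarrow> (nat \<Rightarrow> nat) \<Rightarrow> (nat \<Rightarrow> nat) \<Rightarrow> nat \<Rightarrow> nat \<Rightarrow> (nat \<Rightarrow> nat) \<Rightarrow> bool" where
  "augment_inv g Q par l y h \<longleftrightarrow>
     mates (h(y := 0)) \<and> num_mates (h(y := 0)) = num_mates g \<and>
     par y = Suc (Q l) \<and> (Q l, y) \<in> set es \<and>
     (\<forall>i z. i \<le> l \<longrightarrow> (h(y := 0)) z = Suc (Q i) \<longleftrightarrow> g z = Suc (Q i))"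

lemma augment_init:
  assumes g: "mates g" and inv: "search_inv g Q tail head x e par unre (Suc y)"
  obtains l where "l < tail" "augment_inv g Q par l y g"
proof -
  have y: "par y \<noteq> 0" "g y = 0"
    using search_invD(13)[OF inv] by auto
  obtain l where l: "l < head" "par y = Suc (Q l)" "(Q l, y) \<in> set es"
    using search_invD(7)[OF inv y(1)] by blast
  moreover have "g(y := 0) = g"
    using y by auto
  moreover have "l < tail"
    using l search_invD(1)[OF inv] by simp
  ultimately show thesis
    using that g by (simp add: augment_inv_def)
qed

lemma augment_finish:
  assumes inv: "augment_inv g Q par l y h" and free: "\<And>z. g z \<noteq> Suc (par y - 1)"
  shows "mates (h(y := Suc (par y - 1)))" "num_mates (h(y := Suc (par y - 1))) = Suc (num_mates g)"
proof -
  have par: "par y - 1 = Q l" and e: "(Q l, y) \<in> set es"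
    and h: "mates (h(y := 0))" "num_mates (h(y := 0)) = num_mates g"
    using inv by (auto simp: augment_inv_def)
  have "(h(y := 0)) z \<noteq> Suc (Q l)" for z
    using inv free[unfolded par] by (auto simp only: augment_inv_def)
  then show "mates (h(y := Suc (par y - 1)))"
    using mates_update[OF h(1) e] par by simp
  show "num_mates (h(y := Suc (par y - 1))) = Suc (num_mates g)"
    using num_mates_update[OF h(1), of y "Q l"] h(2) par by simp
qed

text \<open>\<open>Q l\<close> changes its partner from \<open>y'\<close> to \<open>y\<close>,
  whereupon the entry of \<open>y'\<close> is the stale one. The parent of \<open>y'\<close>
  precedes \<open>Q l\<close> in the queue, and since \<open>Q\<close> is injective the entries of
  the earlier vertices are untouched.\<close>

lemma augment_step:
  assumes inv: "augment_inv g Q par l y h" and g: "mates g" and mate: "g y' = Suc (par y - 1)"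
    and sinv: "search_inv g Q tail head x e par unre found" and l: "l < tail"
  obtains l' where "l' < l" "augment_inv g Q par l' y' (h(y := Suc (par y - 1)))"
proof -
  have pary: "par y - 1 = Q l" and e: "(Q l, y) \<in> set es"
    and h: "mates (h(y := 0))" "num_mates (h(y := 0)) = num_mates g"
    and agree: "\<And>i z. i \<le> l \<Longrightarrow> (h(y := 0)) z = Suc (Q i) \<longleftrightarrow> g z = Suc (Q i)"
    using inv by (simp_all only: augment_inv_def diff_Suc_1)
  have y': "(h(y := 0)) y' = Suc (Q l)"
    using agree[of l y'] mate pary by simp
  then have ne: "y' \<noteq> y"
    by auto
  obtain l' where l': "l' < l" "par y' = Suc (Q l')"
    using search_invD(6)[OF sinv l, of y'] mate pary by auto
  then have e': "(Q l', y') \<in> set es"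
    using search_invD(7)[OF sinv, of y'] by auto
  let ?h = "h(y := Suc (Q l))"
  have eq: "?h(y' := 0) = (h(y := 0))(y := Suc (Q l), y' := 0)"
    by simp
  have shift: "mates (?h(y' := 0))" "num_mates (?h(y' := 0)) = num_mates g"
    using mates_shift[OF h(1) e _ y'] h(2) unfolding eq by (metis fun_upd_same)+
  have "(?h(y' := 0)) z = Suc (Q i) \<longleftrightarrow> g z = Suc (Q i)" if "i \<le> l'" for i z
  proof -
    have il: "i < l" "i \<noteq> l" "i < tail"
      using that l' l by auto
    have neq: "Q i \<noteq> Q l"
      using il l search_invD(2)[OF sinv] by (auto dest: inj_onD)
    have "g y' = Suc (Q l)"
      using mate pary by simp
    then show ?thesis
      using agree[of i z] agree[of i y] il neq by auto
  qed
  then have "augment_inv g Q par l' y' ?h"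
    using shift l' e' unfolding augment_inv_def by blast
  then show thesis
    using that l' pary by simp
qed

end


section \<open>Weakest preconditions with a clock\<close>

text \<open>Total correctness: a halting run is demanded. The postcondition sees the clock, which
  shows \<open>n\<close> when \<open>c\<close> starts.\<close>

definition wp :: "com \<Rightarrow> (nat \<Rightarrow> state \<Rightarrow> bool) \<Rightarrow> nat \<Rightarrow> state \<Rightarrow> bool" where
  "wp c Q n s \<longleftrightarrow> (\<exists>t s'. exec c s t s' \<and> Q (n + t) s')"

lemma wpI: "exec c s t s' \<Longrightarrow> Q (n + t) s' \<Longrightarrow> wp c Q n s"
  unfolding wp_def by blast

lemma wp_Skip: "wp Skip Q n s \<longleftrightarrow> Q (Suc n) s"
  using wpI[OF exec.Skip, of Q] by (auto simp: wp_def elim: exec_SkipE)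

lemma wp_Assign: "wp (Assign r e) Q n s \<longleftrightarrow> Q (Suc n) (s\<lparr>reg := (reg s)(r := aval e s)\<rparr>)"
  using wpI[OF exec.Assign, of Q] by (auto simp: wp_def elim: exec_AssignE)

lemma wp_Store: "wp (Store a e f) Q n s \<longleftrightarrow>
    Q (Suc n) (s\<lparr>arr := (arr s)(a := (arr s a)(aval e s := aval f s))\<rparr>)"
  using wpI[OF exec.Store, of Q] by (auto simp: wp_def elim: exec_StoreE)

lemma wp_Seq: "wp (Seq c d) Q n s \<longleftrightarrow> wp c (wp d Q) n s"
proof
  assume "wp (Seq c d) Q n s"
  then obtain t s' where "exec (Seq c d) s t s'" "Q (n + t) s'"
    unfolding wp_def by blast
  then show "wp c (wp d Q) n s"
    by (elim exec_SeqE) (auto simp: wp_def add.assoc)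
next
  assume "wp c (wp d Q) n s"
  then obtain t s' u s'' where "exec c s t s'" "exec d s' u s''" "Q (n + (t + u)) s''"
    by (auto simp: wp_def add.assoc)
  then show "wp (Seq c d) Q n s"
    unfolding wp_def by (blast intro: exec.Seq)
qed

lemma wp_If: "wp (If b c d) Q n s \<longleftrightarrow> (if bval b s then wp c Q (Suc n) s else wp d Q (Suc n) s)"
proof
  assume "wp (If b c d) Q n s"
  then obtain t s' where "exec (If b c d) s t s'" "Q (n + t) s'"
    unfolding wp_def by blast
  then show "if bval b s then wp c Q (Suc n) s else wp d Q (Suc n) s"
    by (elim exec_IfE) (auto simp: wp_def)
next
  assume "if bval b s then wp c Q (Suc n) s else wp d Q (Suc n) s"
  then obtain t s' where "exec (if bval b s then c else d) s t s'" "Q (n + Suc t) s'"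
    by (auto simp: wp_def split: if_splits)
  then show "wp (If b c d) Q n s"
    unfolding wp_def by (metis exec.IfTrue exec.IfFalse)
qed

lemmas wp_simps = wp_Skip wp_Assign wp_Store wp_Seq wp_If

lemma wp_mono: "wp c Q n s \<Longrightarrow> (\<And>n s. Q n s \<Longrightarrow> Q' n s) \<Longrightarrow> wp c Q' n s"
  unfolding wp_def by blast

text \<open>Time bounds serve as termination arguments: an invariant that bounds the clock can only be
  preserved finitely often.\<close>

lemma wp_While:
  assumes "I n s"
    and "\<And>n s. I n s \<Longrightarrow> n \<le> T"
    and "\<And>n s. I n s \<Longrightarrow> bval b s \<Longrightarrow> wp c I (Suc n) s"
    and "\<And>n s. I n s \<Longrightarrow> \<not> bval b s \<Longrightarrow> Q (Suc n) s"
  shows "wp (While b c) Q n s"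
  using assms(1)
proof (induction "T - n" arbitrary: n s rule: less_induct)
  case less
  show ?case
  proof (cases "bval b s")
    case True
    then obtain t s' where t: "exec c s t s'" "I (Suc n + t) s'"
      using assms(3) less.prems unfolding wp_def by blast
    have "T - (Suc n + t) < T - n"
      using assms(2)[OF t(2)] by simp
    then have "wp (While b c) Q (Suc n + t) s'"
      using less.hyps t(2) by blast
    then obtain u s'' where "exec (While b c) s' u s''" "Q (n + Suc (t + u)) s''"
      by (auto simp: wp_def add.assoc)
    then show ?thesis
      using wpI[OF exec.WhileTrue[OF True t(1)]] by blast
  next
    case False
    then show ?thesis
      using assms(4)[OF less.prems] wpI[OF exec.WhileFalse, of b s Q n c] by simp
  qed
qed


section \<open>The program\<close>

abbreviation Then (infixr ";;" 60) where "c ;; d \<equiv> Seq c d"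

definition for_edges :: "com \<Rightarrow> com" where
  "for_edges c = (Assign 3 (Const 0) ;; While (Less (Reg 3) (Reg 2)) (c ;; Assign 3 (Inc (Reg 3))))"

text \<open>\<open>I i\<close> describes the state after \<open>i\<close> edges. Test and increment
  add 2 to the cost \<open>b\<close> of the body; the initial assignment and the last test give the
  summand 2.\<close>

lemma wp_for_edges:
  assumes "reg s 2 = N" "I 0 (s\<lparr>reg := (reg s)(3 := 0)\<rparr>)"
    and step: "\<And>i n s. i < N \<Longrightarrow> reg s 3 = i \<Longrightarrow> reg s 2 = N \<Longrightarrow> I i s \<Longrightarrow>
      wp c (\<lambda>n' s'. n' \<le> n + b \<and> reg s' 3 = i \<and> reg s' 2 = N \<and>
        I (Suc i) (s'\<lparr>reg := (reg s')(3 := Suc i)\<rparr>)) n s"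
    and final: "\<And>n' s'. n' \<le> n + (b + 2) * N + 2 \<Longrightarrow> reg s' 2 = N \<Longrightarrow> I N s' \<Longrightarrow> Q n' s'"
  shows "wp (for_edges c) Q n s"
proof -
  let ?I = "\<lambda>n' s'. reg s' 3 \<le> N \<and> reg s' 2 = N \<and> I (reg s' 3) s' \<and>
    n' \<le> n + 1 + (b + 2) * reg s' 3"
  have "wp (While (Less (Reg 3) (Reg 2)) (c ;; Assign 3 (Inc (Reg 3)))) Q (Suc n)
      (s\<lparr>reg := (reg s)(3 := 0)\<rparr>)"
  proof (rule wp_While[where I = ?I and T = "n + 1 + (b + 2) * N"])
    show "?I (Suc n) (s\<lparr>reg := (reg s)(3 := 0)\<rparr>)"
      using assms(1,2) by simp
  next
    fix n' s' assume "?I n' s'"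
    then show "n' \<le> n + 1 + (b + 2) * N"
      using mult_le_mono2[of "reg s' 3" N "b + 2"] by linarith
  next
    fix n' s' assume I: "?I n' s'" and b: "bval (Less (Reg 3) (Reg 2)) s'"
    have "wp c (\<lambda>n'' s''. n'' \<le> Suc n' + b \<and> reg s'' 3 = reg s' 3 \<and> reg s'' 2 = N \<and>
        I (Suc (reg s' 3)) (s''\<lparr>reg := (reg s'')(3 := Suc (reg s' 3))\<rparr>)) (Suc n') s'"
      by (rule step) (use I b in auto)
    then show "wp (c ;; Assign 3 (Inc (Reg 3))) ?I (Suc n') s'"
      unfolding wp_Seq by (rule wp_mono) (use I b in \<open>auto simp: wp_Assign\<close>)
  next
    fix n' s' assume I: "?I n' s'" and b: "\<not> bval (Less (Reg 3) (Reg 2)) s'"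
    then have "reg s' 3 = N"
      by simp
    then show "Q (Suc n') s'"
      using I final[of "Suc n'" s'] by simp
  qed
  then show ?thesis
    by (simp add: for_edges_def wp_simps)
qed

text \<open>Registers: 3 edge index, 4 bound on the levels, 5 and 6 auxiliary counters, 7 active vertex plus
  one, 8 vertex in \<open>X\<close>, 9 vertex in \<open>Y\<close>, 10 edge or edge pointer, 11 and 12 head and tail of the
  queue, 13 end of the augmenting path plus one. Arrays: 2 marks of the unreached vertices in \<open>X\<close>,
  3 parents of the reached vertices in \<open>Y\<close>, 4 and 5 adjacency lists, 6 partners of the vertices in
  \<open>Y\<close>, 7 edge pointers, 8 levels, 9 labels, 10 partners of the vertices in \<open>X\<close>, 11 queue.\<close>

text \<open>The bound \<open>K\<close> is the index of the triangular number following \<open>min m (min p q)\<close>.\<close>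

definition level_bound_prog :: com where
  "level_bound_prog =
    (Assign 4 (Const 1) ;;
     While (And (Less (Reg 6) (Reg 2)) (And (Less (Reg 6) (Reg 0)) (Less (Reg 6) (Reg 1))))
      (Assign 6 (Inc (Reg 6)) ;; Assign 5 (Inc (Reg 5)) ;;
       If (Equal (Reg 5) (Reg 4)) (Assign 4 (Inc (Reg 4)) ;; Assign 5 (Const 0)) Skip))"

definition adjacency_prog :: com where
  "adjacency_prog =
     for_edges (Store 5 (Reg 3) (Get 4 (Get 0 (Reg 3))) ;; Store 4 (Get 0 (Reg 3)) (Inc (Reg 3)))"

text \<open>The branches realise, in this order, \<open>auction_activate\<close>,
  \<open>auction_skip\<close>, \<open>auction_raise\<close>, \<open>auction_retire\<close>,
  \<open>auction_match\<close> and \<open>auction_reject\<close>. The old partner is read into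
  register 7 before its entry in array 6 is overwritten.\<close>

definition auction_prog :: com where
  "auction_prog =
    (Assign 3 (Const 0) ;;
     While (Not (And (Equal (Reg 3) (Reg 2)) (Equal (Reg 7) (Const 0))))
      (If (Equal (Reg 7) (Const 0))
        (If (Equal (Get 8 (Get 0 (Reg 3))) (Const 0)) (Assign 7 (Inc (Get 0 (Reg 3)))) Skip ;;
         Assign 3 (Inc (Reg 3)))
        (Assign 8 (Minus (Reg 7) (Const 1)) ;;
         If (Equal (Get 7 (Reg 8)) (Const 0))
          (If (Less (Get 8 (Reg 8)) (Reg 4))
            (Store 8 (Reg 8) (Inc (Get 8 (Reg 8))) ;; Store 7 (Reg 8) (Get 4 (Reg 8)))
            (Assign 7 (Const 0)))
          (Assign 10 (Minus (Get 7 (Reg 8)) (Const 1)) ;; Assign 9 (Get 1 (Reg 10)) ;;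
           Store 7 (Reg 8) (Get 5 (Reg 10)) ;;
           If (Less (Get 9 (Reg 9)) (Get 8 (Reg 8)))
            (Store 9 (Reg 9) (Get 8 (Reg 8)) ;; Assign 7 (Get 6 (Reg 9)) ;; Store 6 (Reg 9) (Inc (Reg 8)))
            Skip))))"

text \<open>All loops run over edges, which keeps the cost linear in \<open>m\<close> and leaves
  isolated vertices unmarked. The test of array 2 prevents a source with several edges from being
  enqueued twice.\<close>

definition search_init_prog :: com where
  "search_init_prog =
    (for_edges (Store 2 (Get 0 (Reg 3)) (Const 1) ;; Store 3 (Get 1 (Reg 3)) (Const 0) ;;
       Store 10 (Get 0 (Reg 3)) (Const 0)) ;;
     for_edges (If (Equal (Get 6 (Get 1 (Reg 3))) (Const 0)) Skip
       (Store 10 (Minus (Get 6 (Get 1 (Reg 3))) (Const 1)) (Inc (Get 1 (Reg 3))))) ;;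
     Assign 12 (Const 0) ;;
     for_edges (If (And (Equal (Get 10 (Get 0 (Reg 3))) (Const 0)) (Less (Const 0) (Get 2 (Get 0 (Reg 3)))))
       (Store 2 (Get 0 (Reg 3)) (Const 0) ;; Store 11 (Reg 12) (Get 0 (Reg 3)) ;; Assign 12 (Inc (Reg 12)))
       Skip))"

definition search_prog :: com where
  "search_prog =
    (Assign 11 (Const 0) ;; Assign 10 (Const 0) ;; Assign 13 (Const 0) ;;
     While (And (Equal (Reg 13) (Const 0)) (Not (And (Equal (Reg 10) (Const 0)) (Equal (Reg 11) (Reg 12)))))
      (If (Equal (Reg 10) (Const 0))
        (Assign 8 (Get 11 (Reg 11)) ;; Assign 11 (Inc (Reg 11)) ;; Assign 10 (Get 4 (Reg 8)))
        (Assign 9 (Get 1 (Minus (Reg 10) (Const 1))) ;; Assign 10 (Get 5 (Minus (Reg 10) (Const 1))) ;;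
         If (Equal (Get 3 (Reg 9)) (Const 0))
          (Store 3 (Reg 9) (Inc (Reg 8)) ;;
           If (Equal (Get 6 (Reg 9)) (Const 0))
            (Assign 13 (Inc (Reg 9)))
            (Store 11 (Reg 12) (Minus (Get 6 (Reg 9)) (Const 1)) ;;
             Store 2 (Minus (Get 6 (Reg 9)) (Const 1)) (Const 0) ;;
             Assign 12 (Inc (Reg 12))))
          Skip)))"

text \<open>Array 10 keeps the partners from before the augmentation, so it names the vertex to be
  rematched next; its entry 0 at the unmatched start of the path ends the loop.\<close>

definition augment_prog :: com where
  "augment_prog =
    (Assign 7 (Reg 13) ;;
     While (Less (Const 0) (Reg 7))
      (Assign 9 (Minus (Reg 7) (Const 1)) ;; Assign 8 (Minus (Get 3 (Reg 9)) (Const 1)) ;;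
       Store 6 (Reg 9) (Inc (Reg 8)) ;; Assign 7 (Get 10 (Reg 8))))"

definition partition_prog :: com where
  "partition_prog =
    (level_bound_prog ;; adjacency_prog ;; auction_prog ;; Assign 13 (Const 1) ;;
     While (Less (Const 0) (Reg 13)) (search_init_prog ;; search_prog ;; augment_prog))"

section \<open>Correctness and running time of preprocessing and auction\<close>

context edge_list begin

definition input_ok :: "state \<Rightarrow> bool" where
  "input_ok s \<longleftrightarrow> reg s 0 = p \<and> reg s 1 = q \<and> reg s 2 = m \<and>
     (\<forall>j<m. arr s 0 j = src j \<and> arr s 1 j = tgt j)"

lemma input_okD:
  assumes "input_ok s"
  shows "reg s 0 = p" "reg s 1 = q" "reg s 2 = m" "j < m \<Longrightarrow> arr s 0 j = src j"
    "j < m \<Longrightarrow> arr s (Suc 0) j = tgt j"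
  using assms by (auto simp: input_ok_def)

definition fresh :: "state \<Rightarrow> bool" where
  "fresh s \<longleftrightarrow> reg s 7 = 0 \<and> (\<forall>a\<in>{2, 3, 6, 7, 8, 9, 10}. arr s a = (\<lambda>_. 0))"

lemma wp_level_bound:
  assumes "input_ok s" "fresh s" "arr s 4 = (\<lambda>_. 0)" "reg s 5 = 0" "reg s 6 = 0"
    and Q: "\<And>n' s'. n' \<le> n + 6 * m + 2 \<Longrightarrow> input_ok s' \<Longrightarrow> fresh s' \<Longrightarrow> arr s' 4 = (\<lambda>_. 0) \<Longrightarrow>
      min m (min p q) \<le> reg s' 4 * reg s' 4 \<Longrightarrow>
      reg s' 4 * reg s' 4 \<le> 2 * min m (min p q) + reg s' 4 \<Longrightarrow> Q n' s'"
  shows "wp level_bound_prog Q n s"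
proof -
  let ?b = "And (Less (Reg 6) (Reg 2)) (And (Less (Reg 6) (Reg 0)) (Less (Reg 6) (Reg 1)))"
  \<comment> \<open>With \<open>K\<close> in register 4 and \<open>r\<close> in register 5, the
    counter in register 6 equals \<open>K * (K - 1) / 2 + r\<close> with \<open>r < K\<close>. The
    equation is doubled to avoid the division.\<close>
  let ?I = "\<lambda>n' s'. input_ok s' \<and> fresh s' \<and> arr s' 4 = (\<lambda>_. 0) \<and>
    reg s' 6 \<le> min m (min p q) \<and> reg s' 5 < reg s' 4 \<and>
    2 * reg s' 6 + reg s' 4 = reg s' 4 * reg s' 4 + 2 * reg s' 5 \<and>
    n' + 6 * (m - reg s' 6) \<le> n + 6 * m + 1"
  show ?thesis
    unfolding level_bound_prog_def wp_Seq[of "Assign 4 (Const 1)"] wp_Assign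
  proof (rule wp_While[where I = ?I and T = "n + 6 * m + 1"])
    show "?I (Suc n) (s\<lparr>reg := (reg s)(4 := aval (Const 1) s)\<rparr>)"
      using assms by (simp add: input_ok_def fresh_def)
  next
    fix n' s' assume "?I n' s'"
    then show "n' \<le> n + 6 * m + 1"
      by simp
  next
    fix n' s' assume I: "?I n' s'" and b: "bval ?b s'"
    then show "wp (Assign 6 (Inc (Reg 6)) ;; Assign 5 (Inc (Reg 5)) ;;
       If (Equal (Reg 5) (Reg 4)) (Assign 4 (Inc (Reg 4)) ;; Assign 5 (Const 0)) Skip) ?I (Suc n') s'"
      by (auto simp: wp_simps input_ok_def fresh_def)
  next
    fix n' s' assume I: "?I n' s'" and b: "\<not> bval ?b s'"
    then have "reg s' 6 = min m (min p q)"
      by (auto simp: input_ok_def)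
    moreover have "reg s' 4 \<le> reg s' 4 * reg s' 4"
      by simp
    ultimately have "min m (min p q) \<le> reg s' 4 * reg s' 4"
      "reg s' 4 * reg s' 4 \<le> 2 * min m (min p q) + reg s' 4"
      using I by linarith+
    then show "Q (Suc n') s'"
      using I by (intro Q) auto
  qed
qed

lemma last_edge_Suc:
  "last_edge x i e \<Longrightarrow> last_edge x (Suc i) (if src i = x then Suc i else e)"
  by (auto simp: last_edge_def less_Suc_eq)

lemma wp_adjacency:
  assumes "input_ok s" "fresh s" "arr s 4 = (\<lambda>_. 0)" "reg s 4 = K"
    and Q: "\<And>n' s'. n' \<le> n + 4 * m + 2 \<Longrightarrow> input_ok s' \<Longrightarrow> fresh s' \<Longrightarrow> reg s' 4 = K \<Longrightarrow>
      adjacency (arr s' 4) (arr s' 5) \<Longrightarrow> Q n' s'"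
  shows "wp adjacency_prog Q n s"
proof -
  let ?I = "\<lambda>i s. input_ok s \<and> fresh s \<and> reg s 4 = K \<and>
    (\<forall>x. last_edge x i (arr s 4 x)) \<and> (\<forall>j<i. last_edge (src j) j (arr s 5 j))"
  show ?thesis
    unfolding adjacency_prog_def
  proof (rule wp_for_edges[where N = m and b = 2 and I = ?I])
    fix i n s
    assume i: "i < m" "reg s 3 = i" "reg s 2 = m" and I: "?I i s"
    have "arr s 0 i = src i"
      using I i by (simp add: input_ok_def)
    moreover have "last_edge x (Suc i) (((arr s 4)(src i := Suc i)) x)" for x
      using I last_edge_Suc[of x i "arr s 4 x"] by (cases "src i = x") simp_all
    moreover have "\<forall>j<Suc i. last_edge (src j) j (((arr s 5)(i := arr s 4 (src i))) j)"
      using I by (auto simp: less_Suc_eq)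
    ultimately show "wp (Store 5 (Reg 3) (Get 4 (Get 0 (Reg 3))) ;; Store 4 (Get 0 (Reg 3)) (Inc (Reg 3)))
      (\<lambda>n' s'. n' \<le> n + 2 \<and> reg s' 3 = i \<and> reg s' 2 = m \<and>
        ?I (Suc i) (s'\<lparr>reg := (reg s')(3 := Suc i)\<rparr>)) n s"
      using I i by (simp add: wp_simps input_ok_def fresh_def)
  qed (use assms in \<open>auto simp: input_ok_def fresh_def last_edge_def adjacency_def\<close>)
qed

lemma wp_auction:
  assumes "input_ok s" "fresh s" "adjacency (arr s 4) (arr s 5)" "reg s 4 = K"
    and Q: "\<And>n' s'. n' \<le> n + 24 * (m * K) + 24 * m + 2 \<Longrightarrow> input_ok s' \<Longrightarrow>
      adjacency (arr s' 4) (arr s' 5) \<Longrightarrow> (\<forall>a\<in>{2, 3, 10}. arr s' a = (\<lambda>_. 0)) \<Longrightarrow> mates (arr s' 6) \<Longrightarrow>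
      (\<And>h. mates h \<Longrightarrow> K * num_mates h \<le> K * num_mates (arr s' 6) + num_mates (arr s' 6)) \<Longrightarrow>
      Q n' s'"
  shows "wp auction_prog Q n s"
proof -
  let ?pot = "\<lambda>s. auction_potential K (reg s 3) (reg s 7) (arr s 7) (arr s 8)"
  let ?inv = "\<lambda>s. auction_inv K (reg s 3) (reg s 7) (arr s 7) (arr s 8) (arr s 9) (arr s 6)"
  \<comment> \<open>An iteration takes at most 12 units and lowers the potential, which is at most
    \<open>2 * (m * K) + 2 * m\<close> at the start.\<close>
  let ?I = "\<lambda>n' s'. input_ok s' \<and> adjacency (arr s' 4) (arr s' 5) \<and> reg s' 4 = K \<and>
    (\<forall>a\<in>{2, 3, 10}. arr s' a = (\<lambda>_. 0)) \<and> ?inv s' \<and>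
    n' + 12 * ?pot s' \<le> n + 24 * (m * K) + 24 * m + 1"
  show ?thesis
    unfolding auction_prog_def wp_Seq[of "Assign 3 (Const 0)"] wp_Assign
  proof (rule wp_While[where I = ?I and T = "n + 24 * (m * K) + 24 * m + 1"])
    show "?I (Suc n) (s\<lparr>reg := (reg s)(3 := aval (Const 0) s)\<rparr>)"
      using assms auction_inv_init auction_potential_init[of K] by (simp add: input_ok_def fresh_def)
  next
    fix n' s' assume "?I n' s'"
    then show "n' \<le> n + 24 * (m * K) + 24 * m + 1"
      by simp
  next
    fix n' s' assume I: "?I n' s'" and b: "\<not> bval (Not (And (Equal (Reg 3) (Reg 2)) (Equal (Reg 7) (Const 0)))) s'"
    then have "reg s' 3 = m" "reg s' 7 = 0"
      by (auto simp: input_ok_def)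
    then have "auction_inv K m 0 (arr s' 7) (arr s' 8) (arr s' 9) (arr s' 6)"
      using I by simp
    then show "Q (Suc n') s'"
      using I auction_final auction_invD(2) by (intro Q) auto
  next
    fix n' s' assume I: "?I n' s'" and b: "bval (Not (And (Equal (Reg 3) (Reg 2)) (Equal (Reg 7) (Const 0)))) s'"
    have adj: "adjacency (arr s' 4) (arr s' 5)" and inv: "?inv s'"
      and K: "reg s' 4 = K" and ok: "input_ok s'"
      and time: "n' + 12 * ?pot s' \<le> n + 24 * (m * K) + 24 * m + 1"
      using I by auto
    consider (pick) "reg s' 7 = 0" "reg s' 3 < m" | (step) x where "reg s' 7 = Suc x"
    proof (cases "reg s' 7")
      case 0
      then have "reg s' 3 < m"
        using b ok auction_invD(1)[OF inv] by (auto simp: input_ok_def)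
      then show thesis
        using 0 that(1) by simp
    qed (use that(2) in simp)
    then show "wp
      (If (Equal (Reg 7) (Const 0))
        (If (Equal (Get 8 (Get 0 (Reg 3))) (Const 0)) (Assign 7 (Inc (Get 0 (Reg 3)))) Skip ;;
         Assign 3 (Inc (Reg 3)))
        (Assign 8 (Minus (Reg 7) (Const 1)) ;;
         If (Equal (Get 7 (Reg 8)) (Const 0))
          (If (Less (Get 8 (Reg 8)) (Reg 4))
            (Store 8 (Reg 8) (Inc (Get 8 (Reg 8))) ;; Store 7 (Reg 8) (Get 4 (Reg 8)))
            (Assign 7 (Const 0)))
          (Assign 10 (Minus (Get 7 (Reg 8)) (Const 1)) ;; Assign 9 (Get 1 (Reg 10)) ;;
           Store 7 (Reg 8) (Get 5 (Reg 10)) ;;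
           If (Less (Get 9 (Reg 9)) (Get 8 (Reg 8)))
            (Store 9 (Reg 9) (Get 8 (Reg 8)) ;; Assign 7 (Get 6 (Reg 9)) ;; Store 6 (Reg 9) (Inc (Reg 8)))
            Skip))) ?I (Suc n') s'"
    proof cases
      case pick
      note src = input_okD(4)[OF ok pick(2)]
      show ?thesis
      proof (cases "arr s' 8 (src (reg s' 3)) = 0")
        case True
        from auction_activate[OF inv[unfolded pick(1)] pick(2) True] show ?thesis
          using I pick(1) src True by (simp add: wp_simps input_ok_def)
      next
        case False
        from auction_skip[OF inv[unfolded pick(1)] pick(2) False] show ?thesis
          using I pick(1) src False by (simp add: wp_simps input_ok_def)
      qed
    next
      case (step x)
      note inv' = inv[unfolded step]
      show ?thesis
      proof (cases "arr s' 7 x = 0")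
        case ptr: True
        show ?thesis
        proof (cases "arr s' 8 x < K")
          case True
          from auction_raise[OF adj inv' ptr True] show ?thesis
            using I step ptr True by (simp add: wp_simps input_ok_def)
        next
          case False
          from auction_retire[OF inv' ptr False] show ?thesis
            using I step ptr False by (simp add: wp_simps input_ok_def)
        qed
      next
        case False
        then obtain j where j: "arr s' 7 x = Suc j" "j < m"
          using auction_pointer[OF inv'] by metis
        note tgt = input_okD(5)[OF ok j(2)]
        show ?thesis
        proof (cases "arr s' 9 (tgt j) < arr s' 8 x")
          case True
          from auction_match[OF adj inv' j(1) True] show ?thesis
            using I step j tgt True by (simp add: wp_simps input_ok_def)
        next
          case False
          from auction_reject[OF adj inv' j(1) False] show ?thesis
            using I step j tgt False by (simp add: wp_simps input_ok_def)
        qed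
      qed
    qed
  qed
qed

section \<open>The steps of a phase: initialisation, search and augmentation\<close>

definition partners :: "(nat \<Rightarrow> nat) \<Rightarrow> (nat \<Rightarrow> nat) \<Rightarrow> bool" where
  "partners g f \<longleftrightarrow> (\<forall>x y. f x = Suc y \<longleftrightarrow> g y = Suc x)"

text \<open>A loop over the edges can clear only entries at endpoints of edges, so no other entry
  may be left over from an earlier phase.\<close>

definition supported :: "state \<Rightarrow> bool" where
  "supported s \<longleftrightarrow> (\<forall>x. arr s 2 x \<noteq> 0 \<longrightarrow> x \<in> srcs) \<and> (\<forall>y. arr s 3 y \<noteq> 0 \<longrightarrow> y \<in> tgts) \<and>
     (\<forall>x. arr s 10 x \<noteq> 0 \<longrightarrow> x \<in> srcs)"

definition graph_ok :: "(nat \<Rightarrow> nat) \<Rightarrow> state \<Rightarrow> bool" where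
  "graph_ok g s \<longleftrightarrow> input_ok s \<and> adjacency (arr s 4) (arr s 5) \<and> arr s 6 = g"

lemma wp_reset:
  assumes "graph_ok g s" "supported s"
    and Q: "\<And>n' s'. n' \<le> n + 5 * m + 2 \<Longrightarrow> graph_ok g s' \<Longrightarrow> (\<And>x. arr s' 2 x \<noteq> 0 \<longleftrightarrow> x \<in> srcs) \<Longrightarrow>
      arr s' 3 = (\<lambda>_. 0) \<Longrightarrow> arr s' 10 = (\<lambda>_. 0) \<Longrightarrow> Q n' s'"
  shows "wp (for_edges (Store 2 (Get 0 (Reg 3)) (Const 1) ;; Store 3 (Get 1 (Reg 3)) (Const 0) ;;
       Store 10 (Get 0 (Reg 3)) (Const 0))) Q n s"
proof -
  let ?I = "\<lambda>i s. graph_ok g s \<and> supported s \<and>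
    (\<forall>j<i. arr s 2 (src j) \<noteq> 0 \<and> arr s 3 (tgt j) = 0 \<and> arr s 10 (src j) = 0)"
  show ?thesis
  proof (rule wp_for_edges[where N = m and b = 3 and I = ?I])
    fix i n s
    assume i: "i < m" "reg s 3 = i" "reg s 2 = m" and I: "?I i s"
    have "arr s 0 i = src i" "arr s (Suc 0) i = tgt i"
      using I i by (auto simp: graph_ok_def input_ok_def)
    then show "wp (Store 2 (Get 0 (Reg 3)) (Const 1) ;; Store 3 (Get 1 (Reg 3)) (Const 0) ;;
       Store 10 (Get 0 (Reg 3)) (Const 0))
      (\<lambda>n' s'. n' \<le> n + 3 \<and> reg s' 3 = i \<and> reg s' 2 = m \<and>
        ?I (Suc i) (s'\<lparr>reg := (reg s')(3 := Suc i)\<rparr>)) n s"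
      using I i by (auto simp: wp_simps input_ok_def graph_ok_def supported_def less_Suc_eq)
  next
    fix n' s' assume n': "n' \<le> n + (3 + 2) * m + 2" and I: "?I m s'"
    show "Q n' s'"
    proof (rule Q)
      show "arr s' 2 x \<noteq> 0 \<longleftrightarrow> x \<in> srcs" for x
        using I by (auto simp: supported_def srcs_def)
      have "arr s' 3 y = 0" for y
        using I by (cases "y \<in> tgts") (auto simp: supported_def tgts_def)
      then show "arr s' 3 = (\<lambda>_. 0)"
        by blast
      have "arr s' 10 x = 0" for x
        using I by (cases "x \<in> srcs") (auto simp: supported_def srcs_def)
      then show "arr s' 10 = (\<lambda>_. 0)"
        by blast
    qed (use n' I in auto)
  qed (use assms in \<open>auto simp: graph_ok_def input_ok_def supported_def\<close>)
qed

lemma wp_partners: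
  assumes g: "mates g" and "graph_ok g s" "\<And>x. arr s 2 x \<noteq> 0 \<longleftrightarrow> x \<in> srcs" "arr s 3 = (\<lambda>_. 0)"
    "arr s 10 = (\<lambda>_. 0)"
    and Q: "\<And>n' s'. n' \<le> n + 4 * m + 2 \<Longrightarrow> graph_ok g s' \<Longrightarrow> (\<And>x. arr s' 2 x \<noteq> 0 \<longleftrightarrow> x \<in> srcs) \<Longrightarrow>
      arr s' 3 = (\<lambda>_. 0) \<Longrightarrow> partners g (arr s' 10) \<Longrightarrow> Q n' s'"
  shows "wp (for_edges (If (Equal (Get 6 (Get 1 (Reg 3))) (Const 0)) Skip
       (Store 10 (Minus (Get 6 (Get 1 (Reg 3))) (Const 1)) (Inc (Get 1 (Reg 3)))))) Q n s"
proof -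
  let ?I = "\<lambda>i s. graph_ok g s \<and> (\<forall>x. arr s 2 x \<noteq> 0 \<longleftrightarrow> x \<in> srcs) \<and> arr s 3 = (\<lambda>_. 0) \<and>
    (\<forall>x y. arr s 10 x = Suc y \<longleftrightarrow> g y = Suc x \<and> y \<in> (\<lambda>j. tgt j) ` {..<i})"
  show ?thesis
  proof (rule wp_for_edges[where N = m and b = 2 and I = ?I])
    fix i n s
    assume i: "i < m" "reg s 3 = i" "reg s 2 = m" and I: "?I i s"
    have tgt: "arr s (Suc 0) i = tgt i" and g6: "arr s 6 = g"
      using I i by (auto simp: graph_ok_def input_ok_def)
    have old: "arr s 10 x = Suc y \<longleftrightarrow> g y = Suc x \<and> y \<in> (\<lambda>j. tgt j) ` {..<i}" for x y
      using I by blast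
    show "wp (If (Equal (Get 6 (Get 1 (Reg 3))) (Const 0)) Skip
       (Store 10 (Minus (Get 6 (Get 1 (Reg 3))) (Const 1)) (Inc (Get 1 (Reg 3)))))
      (\<lambda>n' s'. n' \<le> n + 2 \<and> reg s' 3 = i \<and> reg s' 2 = m \<and>
        ?I (Suc i) (s'\<lparr>reg := (reg s')(3 := Suc i)\<rparr>)) n s"
    proof (cases "g (tgt i)")
      case 0
      then have "arr s 10 x = Suc y \<longleftrightarrow> g y = Suc x \<and> y \<in> (\<lambda>j. tgt j) ` {..<Suc i}" for x y
        using old[of x y] by (auto simp: lessThan_Suc)
      then show ?thesis
        using I i tgt g6 0 by (simp add: wp_simps input_ok_def graph_ok_def)
    next
      case (Suc z)
      have "((arr s 10)(z := Suc (tgt i))) x = Suc y \<longleftrightarrow>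
          g y = Suc x \<and> y \<in> (\<lambda>j. tgt j) ` {..<Suc i}" for x y
      proof (cases "x = z")
        case True
        then show ?thesis
          using Suc mates_inj[OF g, of y z "tgt i"] by (auto simp: lessThan_Suc)
      next
        case False
        then show ?thesis
          using old[of x y] Suc by (auto simp: lessThan_Suc)
      qed
      then show ?thesis
        using I i tgt g6 Suc by (simp add: wp_simps input_ok_def graph_ok_def)
    qed
  next
    fix n' s' assume n': "n' \<le> n + (2 + 2) * m + 2" and I: "?I m s'"
    show "Q n' s'"
    proof (rule Q)
      have "y \<in> (\<lambda>j. tgt j) ` {..<m}" if "g y = Suc x" for x y
        using edge_tgt[OF mates_edge[OF g that]] by (simp add: tgts_def)
      then show "partners g (arr s' 10)"
        using I by (auto simp: partners_def)
    qed (use n' I in auto)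
  qed (use assms in \<open>auto simp: graph_ok_def input_ok_def\<close>)
qed

lemma wp_enqueue_free:
  assumes g: "mates g" and "graph_ok g s" "\<And>x. arr s 2 x \<noteq> 0 \<longleftrightarrow> x \<in> srcs" "arr s 3 = (\<lambda>_. 0)"
    "partners g (arr s 10)" "reg s 12 = 0"
    and Q: "\<And>n' s'. n' \<le> n + 6 * m + 2 \<Longrightarrow> graph_ok g s' \<Longrightarrow> partners g (arr s' 10) \<Longrightarrow>
      (\<And>x. search_inv g (arr s' 11) (reg s' 12) 0 x 0 (arr s' 3) (arr s' 2) 0) \<Longrightarrow> Q n' s'"
  shows "wp (for_edges (If (And (Equal (Get 10 (Get 0 (Reg 3))) (Const 0)) (Less (Const 0) (Get 2 (Get 0 (Reg 3)))))
       (Store 2 (Get 0 (Reg 3)) (Const 0) ;; Store 11 (Reg 12) (Get 0 (Reg 3)) ;; Assign 12 (Inc (Reg 12)))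
       Skip)) Q n s"
proof -
  \<comment> \<open>The queue holds the unmatched sources among the first \<open>i\<close> edges,
    and the marks are those of the sources outside it.\<close>
  let ?I = "\<lambda>i s. graph_ok g s \<and> arr s 3 = (\<lambda>_. 0) \<and> partners g (arr s 10) \<and>
    inj_on (arr s 11) {..<reg s 12} \<and>
    arr s 11 ` {..<reg s 12} = {x \<in> (\<lambda>j. src j) ` {..<i}. arr s 10 x = 0} \<and>
    (\<forall>x. arr s 2 x \<noteq> 0 \<longleftrightarrow> x \<in> srcs \<and> x \<notin> arr s 11 ` {..<reg s 12})"
  show ?thesis
  proof (rule wp_for_edges[where N = m and b = 4 and I = ?I])
    fix i n s
    assume i: "i < m" "reg s 3 = i" "reg s 2 = m" and I: "?I i s"
    have src: "arr s 0 i = src i"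
      using I i by (auto simp: graph_ok_def input_ok_def)
    have basic: "graph_ok g s" "arr s 3 = (\<lambda>_. 0)" "partners g (arr s 10)"
      and inj: "inj_on (arr s 11) {..<reg s 12}"
      and unre: "\<forall>x. arr s 2 x \<noteq> 0 \<longleftrightarrow> x \<in> srcs \<and> x \<notin> arr s 11 ` {..<reg s 12}"
      using I by blast+
    show "wp (If (And (Equal (Get 10 (Get 0 (Reg 3))) (Const 0)) (Less (Const 0) (Get 2 (Get 0 (Reg 3)))))
       (Store 2 (Get 0 (Reg 3)) (Const 0) ;; Store 11 (Reg 12) (Get 0 (Reg 3)) ;; Assign 12 (Inc (Reg 12)))
       Skip)
      (\<lambda>n' s'. n' \<le> n + 4 \<and> reg s' 3 = i \<and> reg s' 2 = m \<and>
        ?I (Suc i) (s'\<lparr>reg := (reg s')(3 := Suc i)\<rparr>)) n s"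
    proof (cases "arr s 10 (src i) = 0 \<and> 0 < arr s 2 (src i)")
      case True
      let ?Q = "(arr s 11)(reg s 12 := src i)"
      have new: "src i \<notin> arr s 11 ` {..<reg s 12}"
        using I True by blast
      have im: "?Q ` {..<Suc (reg s 12)} = insert (src i) (arr s 11 ` {..<reg s 12})"
        by (auto simp: lessThan_Suc)
      have "inj_on ?Q {..<Suc (reg s 12)}"
        using inj new by (rule inj_on_enqueue)
      moreover have "?Q ` {..<Suc (reg s 12)} = {x \<in> (\<lambda>j. src j) ` {..<Suc i}. arr s 10 x = 0}"
        unfolding im using I True by (auto simp: lessThan_Suc)
      moreover have "((arr s 2)(src i := 0)) x \<noteq> 0 \<longleftrightarrow> x \<in> srcs \<and> x \<notin> ?Q ` {..<Suc (reg s 12)}" for x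
        unfolding im using I by auto
      ultimately show ?thesis
        using basic i src True by (simp add: wp_simps input_ok_def graph_ok_def)
    next
      case False
      have "arr s 11 ` {..<reg s 12} = {x \<in> (\<lambda>j. src j) ` {..<Suc i}. arr s 10 x = 0}"
        using I False src_in[OF i(1)] by (auto simp: lessThan_Suc)
      moreover have "\<not> bval (And (Equal (Get 10 (Get 0 (Reg 3))) (Const 0)) (Less (Const 0) (Get 2 (Get 0 (Reg 3))))) s"
        using False src i by simp
      ultimately show ?thesis
        using basic inj unre i by (simp add: wp_If wp_Skip input_ok_def graph_ok_def del: bval.simps)
    qed
  next
    fix n' s' assume n': "n' \<le> n + (4 + 2) * m + 2" and I: "?I m s'"
    have im: "arr s' 11 ` {..<reg s' 12} = {x \<in> srcs. arr s' 10 x = 0}"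
      using I by (simp add: srcs_def)
    show "Q n' s'"
    proof (rule Q)
      fix x
      have free: "arr s' 10 z = 0 \<longleftrightarrow> (\<forall>y. g y \<noteq> Suc z)" for z
        using I by (metis not0_implies_Suc partners_def zero_neq_one nat.simps(3))
      show "search_inv g (arr s' 11) (reg s' 12) 0 x 0 (arr s' 3) (arr s' 2) 0"
      proof (rule search_invI)
        show "arr s' 11 i \<in> srcs" if "i < reg s' 12" for i
          using im that by auto
        show "z \<in> arr s' 11 ` {..<reg s' 12}" if "z \<in> srcs" "\<forall>y. g y \<noteq> Suc z" for z
          unfolding im using that free by simp
        show "\<exists>l<i. arr s' 3 y = Suc (arr s' 11 l)" if "i < reg s' 12" "g y = Suc (arr s' 11 i)" for i y
          using that im free by auto
      qed (use I in auto)
    qed (use n' I in auto)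
  qed (use assms in \<open>auto simp: graph_ok_def input_ok_def\<close>)
qed

lemma wp_search_init:
  assumes g: "mates g" and s: "graph_ok g s" "supported s"
    and Q: "\<And>n' s'. n' \<le> n + 15 * m + 7 \<Longrightarrow> graph_ok g s' \<Longrightarrow> partners g (arr s' 10) \<Longrightarrow>
      (\<And>x. search_inv g (arr s' 11) (reg s' 12) 0 x 0 (arr s' 3) (arr s' 2) 0) \<Longrightarrow> Q n' s'"
  shows "wp search_init_prog Q n s"
  unfolding search_init_prog_def wp_Seq
proof (rule wp_reset[OF s], rule wp_partners[OF g], assumption+)
  fix n1 s1 n2 s2
  assume 1: "n1 \<le> n + 5 * m + 2" and 2: "n2 \<le> n1 + 4 * m + 2" "graph_ok g s2"
    "\<And>x. arr s2 2 x \<noteq> 0 \<longleftrightarrow> x \<in> srcs" "arr s2 3 = (\<lambda>_. 0)" "partners g (arr s2 10)"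
  show "wp (Assign 12 (Const 0)) (wp (for_edges (If (And (Equal (Get 10 (Get 0 (Reg 3))) (Const 0))
      (Less (Const 0) (Get 2 (Get 0 (Reg 3)))))
       (Store 2 (Get 0 (Reg 3)) (Const 0) ;; Store 11 (Reg 12) (Get 0 (Reg 3)) ;; Assign 12 (Inc (Reg 12)))
       Skip)) Q) n2 s2"
    unfolding wp_Assign
    by (rule wp_enqueue_free[OF g]) (use 1 2 Q in \<open>auto simp: graph_ok_def input_ok_def\<close>)
qed

lemma wp_search:
  assumes g: "mates g" and s: "graph_ok g s" "partners g (arr s 10)"
    "\<And>x. search_inv g (arr s 11) (reg s 12) 0 x 0 (arr s 3) (arr s 2) 0"
    and Q: "\<And>n' s'. n' \<le> n + 20 * m + 4 \<Longrightarrow> graph_ok g s' \<Longrightarrow> partners g (arr s' 10) \<Longrightarrow>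
      search_inv g (arr s' 11) (reg s' 12) (reg s' 11) (reg s' 8) (reg s' 10) (arr s' 3) (arr s' 2) (reg s' 13)
      \<Longrightarrow> (reg s' 13 = 0 \<Longrightarrow> reg s' 10 = 0 \<and> reg s' 11 = reg s' 12) \<Longrightarrow> Q n' s'"
  shows "wp search_prog Q n s"
proof -
  let ?b = "And (Equal (Reg 13) (Const 0)) (Not (And (Equal (Reg 10) (Const 0)) (Equal (Reg 11) (Reg 12))))"
  let ?inv = "\<lambda>s. search_inv g (arr s 11) (reg s 12) (reg s 11) (reg s 8) (reg s 10) (arr s 3) (arr s 2) (reg s 13)"
  let ?pot = "\<lambda>s. search_potential (arr s 11) (reg s 11) (reg s 10)"
  \<comment> \<open>An iteration takes at most 10 units and lowers the potential, which is at most
    \<open>2 * m\<close> at the start.\<close>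
  let ?I = "\<lambda>n' s'. graph_ok g s' \<and> partners g (arr s' 10) \<and> ?inv s' \<and> n' + 10 * ?pot s' \<le> n + 20 * m + 3"
  have pot0: "10 * search_potential (arr s 11) 0 0 \<le> 20 * m"
    using search_potential_init[of "arr s 11"] by simp
  show ?thesis
    unfolding search_prog_def wp_Seq[of "Assign _ _"] wp_Assign
  proof (rule wp_While[where I = ?I and T = "n + 20 * m + 3"])
    fix n' s' assume "?I n' s'" "\<not> bval ?b s'"
    then show "Q (Suc n') s'"
      by (intro Q) auto
  next
    fix n' s' assume I: "?I n' s'" and b: "bval ?b s'"
    then have adj: "adjacency (arr s' 4) (arr s' 5)" and g6: "arr s' 6 = g" and ok: "input_ok s'"
      and found: "reg s' 13 = 0" and inv: "?inv s'"
      by (auto simp: graph_ok_def)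
    note inv = inv[unfolded found]
    show "wp (If (Equal (Reg 10) (Const 0))
        (Assign 8 (Get 11 (Reg 11)) ;; Assign 11 (Inc (Reg 11)) ;; Assign 10 (Get 4 (Reg 8)))
        (Assign 9 (Get 1 (Minus (Reg 10) (Const 1))) ;; Assign 10 (Get 5 (Minus (Reg 10) (Const 1))) ;;
         If (Equal (Get 3 (Reg 9)) (Const 0))
          (Store 3 (Reg 9) (Inc (Reg 8)) ;;
           If (Equal (Get 6 (Reg 9)) (Const 0))
            (Assign 13 (Inc (Reg 9)))
            (Store 11 (Reg 12) (Minus (Get 6 (Reg 9)) (Const 1)) ;;
             Store 2 (Minus (Get 6 (Reg 9)) (Const 1)) (Const 0) ;;
             Assign 12 (Inc (Reg 12))))
          Skip)) ?I (Suc n') s'"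
    proof (cases "reg s' 10")
      case 0
      then have "reg s' 11 < reg s' 12"
        using b found search_invD(1)[OF inv] by auto
      from search_dequeue[OF adj inv[unfolded 0] this] show ?thesis
        using I 0 found by (simp add: wp_simps graph_ok_def input_ok_def)
    next
      case (Suc j)
      note inv' = inv[unfolded Suc]
      note j = search_pointer(4)[OF inv']
      note tgt = input_okD(5)[OF ok j] and pot = search_scan_potential[OF adj inv']
      show ?thesis
      proof (cases "arr s' 3 (tgt j) = 0")
        case False
        from search_visited[OF adj inv' False] show ?thesis
          using I Suc found tgt pot False by (simp add: wp_simps graph_ok_def input_ok_def)
      next
        case new: True
        show ?thesis
        proof (cases "g (tgt j)")
          case 0
          from search_found[OF adj inv' new 0] show ?thesis
            using I Suc found tgt pot new 0 g6 by (simp add: wp_simps graph_ok_def input_ok_def)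
        next
          case mate: (Suc x')
          from search_enqueue[OF adj g inv' new mate] show ?thesis
            using I Suc found tgt new mate g6 by (simp add: wp_simps graph_ok_def input_ok_def)
        qed
      qed
    qed
  qed (use s pot0 in \<open>auto simp: graph_ok_def input_ok_def\<close>)
qed

lemma wp_augment:
  assumes g: "mates g" and s: "graph_ok g s" "partners g (arr s 10)"
    and inv: "search_inv g (arr s 11) (reg s 12) (reg s 11) (reg s 8) (reg s 10) (arr s 3) (arr s 2) (reg s 13)"
    and Q: "\<And>n' s'. n' \<le> n + 5 * m + 2 \<Longrightarrow> input_ok s' \<Longrightarrow> reg s' 13 = reg s 13 \<Longrightarrow>
      (\<And>a. a \<noteq> 6 \<Longrightarrow> arr s' a = arr s a) \<Longrightarrow>
      (reg s 13 \<noteq> 0 \<Longrightarrow> mates (arr s' 6) \<and> num_mates (arr s' 6) = Suc (num_mates g)) \<Longrightarrow> Q n' s'"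
  shows "wp augment_prog Q n s"
proof -
  let ?T = "n + 5 * m + 1"
  let ?aug = "\<lambda>l y h. augment_inv g (arr s 11) (arr s 3) l y h"
  \<comment> \<open>The queue position \<open>l\<close> strictly decreases, so at most
    \<open>Suc l\<close> iterations of 5 units each remain. Register 7 is zero once the path has
    been flipped, or from the beginning if none was found.\<close>
  let ?I = "\<lambda>n' s'. input_ok s' \<and> reg s' 13 = reg s 13 \<and> (\<forall>a. a \<noteq> 6 \<longrightarrow> arr s' a = arr s a) \<and>
    (if reg s' 7 = 0
     then n' \<le> ?T \<and> (reg s 13 \<noteq> 0 \<longrightarrow> mates (arr s' 6) \<and> num_mates (arr s' 6) = Suc (num_mates g))
     else \<exists>l<reg s 12. ?aug l (reg s' 7 - 1) (arr s' 6) \<and> n' + 5 * Suc l \<le> ?T)"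
  have tail: "reg s 12 \<le> m"
    using search_tail_le search_invD(2,3)[OF inv] by blast
  show ?thesis
    unfolding augment_prog_def wp_Seq[of "Assign 7 _"] wp_Assign
  proof (rule wp_While[where I = ?I and T = ?T])
    show "?I (Suc n) (s\<lparr>reg := (reg s)(7 := aval (Reg 13) s)\<rparr>)"
    proof (cases "reg s 13")
      case 0
      then show ?thesis
        using s by (simp add: graph_ok_def input_ok_def)
    next
      case (Suc y)
      obtain l where l: "l < reg s 12" "?aug l y g"
        using augment_init[OF g inv[unfolded Suc]] by blast
      then have "\<exists>l<reg s 12. ?aug l y g \<and> Suc n + 5 * Suc l \<le> ?T"
        using tail by (intro exI[of _ l]) auto
      then show ?thesis
        using s Suc by (simp add: graph_ok_def input_ok_def)
    qed
  next
    fix n' s' assume "?I n' s'"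
    then show "n' \<le> ?T"
      by (auto split: if_splits)
  next
    fix n' s' assume "?I n' s'" "\<not> bval (Less (Const 0) (Reg 7)) s'"
    then show "Q (Suc n') s'"
      by (intro Q) auto
  next
    fix n' s' assume I: "?I n' s'" and b: "bval (Less (Const 0) (Reg 7)) s'"
    define h where "h = arr s' 6"
    obtain y where y: "reg s' 7 = Suc y"
      using b by (auto simp: gr0_conv_Suc)
    then obtain l where l: "l < reg s 12" "?aug l y h" "n' + 5 * Suc l \<le> ?T"
      using I by (auto simp: h_def)
    define x where "x = arr s 3 y - Suc 0"
    define h' where "h' = h(y := Suc x)"
    have "if arr s 10 x = 0
      then n' + 5 \<le> ?T \<and> (reg s 13 \<noteq> 0 \<longrightarrow> mates h' \<and> num_mates h' = Suc (num_mates g))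
      else \<exists>l<reg s 12. ?aug l (arr s 10 x - 1) h' \<and> n' + 5 + 5 * Suc l \<le> ?T"
    proof (cases "arr s 10 x")
      case 0
      then have "g z \<noteq> Suc x" for z
        using s(2) unfolding partners_def by (metis nat.simps(3))
      then show ?thesis
        using 0 l augment_finish[OF l(2)] by (simp add: x_def h'_def)
    next
      case (Suc y')
      then have mate: "g y' = Suc (arr s 3 y - 1)"
        using s(2) by (simp add: partners_def x_def)
      obtain l' where "l' < l" "?aug l' y' h'"
        using augment_step[OF l(2) g mate inv l(1)] by (auto simp: h'_def x_def)
      then have "\<exists>l<reg s 12. ?aug l y' h' \<and> n' + 5 + 5 * Suc l \<le> ?T"
        using l by (intro exI[of _ l']) auto
      then show ?thesis
        using Suc by simp
    qed
    then show "wp (Assign 9 (Minus (Reg 7) (Const 1)) ;; Assign 8 (Minus (Get 3 (Reg 9)) (Const 1)) ;;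
       Store 6 (Reg 9) (Inc (Reg 8)) ;; Assign 7 (Get 10 (Reg 8))) ?I (Suc n') s'"
      using I y s(1) by (cases "arr s 10 x = 0")
        (simp_all add: wp_simps graph_ok_def input_ok_def x_def[symmetric] h_def[symmetric] h'_def[symmetric])
  qed
qed

section \<open>Phases and the total running time\<close>

definition result :: "state \<Rightarrow> bool" where
  "result s \<longleftrightarrow> envy_free_partition {..<p} {..<q} (set es)
    {x. x < p \<and> arr s 2 x = 0} {x. x < p \<and> arr s 2 x \<noteq> 0}
    {y. y < q \<and> arr s 3 y \<noteq> 0} {y. y < q \<and> arr s 3 y = 0}"

text \<open>Either the search fails and its marks, which augmentation does not touch, are the
  partition, or the matching grows by one edge.\<close>

lemma wp_phase:
  assumes g: "mates g" and s: "graph_ok g s" "supported s"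
    and Q: "\<And>n' s'. n' \<le> n + 40 * m + 13 \<Longrightarrow> reg s' 13 = 0 \<Longrightarrow> result s' \<Longrightarrow> Q n' s'"
      "\<And>n' s' g'. n' \<le> n + 40 * m + 13 \<Longrightarrow> reg s' 13 \<noteq> 0 \<Longrightarrow> graph_ok g' s' \<Longrightarrow> supported s' \<Longrightarrow>
        mates g' \<Longrightarrow> num_mates g' = Suc (num_mates g) \<Longrightarrow> Q n' s'"
  shows "wp (search_init_prog ;; search_prog ;; augment_prog) Q n s"
  unfolding wp_Seq
proof (rule wp_search_init[OF g s], rule wp_search[OF g], assumption+, rule wp_augment[OF g], assumption+)
  fix n1 s1 n2 s2 n3 s3
  assume n: "n1 \<le> n + 15 * m + 7" "n2 \<le> n1 + 20 * m + 4" "n3 \<le> n2 + 5 * m + 2"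
    and s2: "graph_ok g s2" "partners g (arr s2 10)"
    and inv: "search_inv g (arr s2 11) (reg s2 12) (reg s2 11) (reg s2 8) (reg s2 10) (arr s2 3) (arr s2 2)
      (reg s2 13)"
    and stop: "reg s2 13 = 0 \<Longrightarrow> reg s2 10 = 0 \<and> reg s2 11 = reg s2 12"
    and s3: "input_ok s3" "reg s3 13 = reg s2 13" and arr: "\<And>a. a \<noteq> 6 \<Longrightarrow> arr s3 a = arr s2 a"
    and aug:
      "reg s2 13 \<noteq> 0 \<Longrightarrow> mates (arr s3 6) \<and> num_mates (arr s3 6) = Suc (num_mates g)"
  show "Q n3 s3"
  proof (cases "reg s2 13 = 0")
    case True
    then have "search_inv g (arr s2 11) (reg s2 12) (reg s2 12) (reg s2 8) 0 (arr s2 3) (arr s2 2) 0"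
      using inv stop by simp
    from search_closed[OF g this] show ?thesis
      using True n s3(2) arr by (intro Q(1)) (auto simp: result_def)
  next
    case False
    have "arr s2 3 y \<noteq> 0 \<Longrightarrow> y \<in> tgts" for y
      using search_invD(7)[OF inv, of y] edge_tgt by blast
    moreover have "x \<in> srcs" if x: "arr s2 10 x \<noteq> 0" for x
    proof -
      obtain y where "arr s2 10 x = Suc y"
        using x not0_implies_Suc by blast
      then have "g y = Suc x"
        using s2(2) by (simp add: partners_def)
      then show ?thesis
        using mates_edge[OF g] edge_src by blast
    qed
    ultimately have "supported s3"
      unfolding supported_def using arr search_invD(4)[OF inv] by simp
    moreover have "graph_ok (arr s3 6) s3"
      using s2(1) s3(1) arr by (simp add: graph_ok_def)
    ultimately show ?thesis
      using False n s3 aug by (intro Q(2)) auto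
  qed
qed

text \<open>At most \<open>K\<close> phases can enlarge the matching, and one more fails. The factor
  \<open>40 * m + 20\<close> covers a phase and its loop test, and the invariant multiplies it by
  the number of phases still possible.\<close>

lemma wp_phases:
  assumes g: "mates g" and s: "graph_ok g s" "supported s" "reg s 13 \<noteq> 0"
    and bound: "\<And>h. mates h \<Longrightarrow> num_mates h \<le> num_mates g + K"
    and Q: "\<And>n' s'. n' \<le> n + (40 * m + 20) * Suc K + 1 \<Longrightarrow> result s' \<Longrightarrow> Q n' s'"
  shows "wp (While (Less (Const 0) (Reg 13)) (search_init_prog ;; search_prog ;; augment_prog)) Q n s"
proof -
  let ?c = "40 * m + 20"
  let ?T = "n + ?c * Suc K"
  let ?I = "\<lambda>n' s'. if reg s' 13 = 0 then n' \<le> ?T \<and> result s' else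
    \<exists>g'. mates g' \<and> graph_ok g' s' \<and> supported s' \<and>
      n' + ?c * (Suc (num_mates g + K) - num_mates g') \<le> ?T"
  show ?thesis
  proof (rule wp_While[where I = ?I and T = ?T])
    show "?I n s"
      using g s by auto
  next
    fix n' s' assume "?I n' s'"
    then show "n' \<le> ?T"
      by (auto split: if_splits)
  next
    fix n' s' assume "?I n' s'" "\<not> bval (Less (Const 0) (Reg 13)) s'"
    then show "Q (Suc n') s'"
      by (intro Q) auto
  next
    fix n' s' assume I: "?I n' s'" and b: "bval (Less (Const 0) (Reg 13)) s'"
    then obtain g' where g': "mates g'" "graph_ok g' s'" "supported s'"
      and time: "n' + ?c * (Suc (num_mates g + K) - num_mates g') \<le> ?T"
      by auto
    have split: "?c * (Suc (num_mates g + K) - num_mates g') =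
        ?c + ?c * (Suc (num_mates g + K) - Suc (num_mates g'))"
      using bound[OF g'(1)] by (simp add: Suc_diff_le)
    show "wp (search_init_prog ;; search_prog ;; augment_prog) ?I (Suc n') s'"
    proof (rule wp_phase[OF g'])
      fix n'' s'' assume "n'' \<le> Suc n' + 40 * m + 13" "reg s'' 13 = 0" "result s''"
      then show "?I n'' s''"
        using time split by simp
    next
      fix n'' s'' g''
      assume *: "n'' \<le> Suc n' + 40 * m + 13" "reg s'' 13 \<noteq> 0" "graph_ok g'' s''" "supported s''"
        "mates g''" "num_mates g'' = Suc (num_mates g')"
      have "n'' + ?c * (Suc (num_mates g + K) - num_mates g'') \<le> ?T"
        unfolding *(6) using *(1) time split by linarith
      then show "?I n'' s''"
        using * by auto
    qed
  qed
qed

lemma exec_partition_prog: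
  obtains t s K where "exec partition_prog (input_state p q es) t s" "result s"
    "K * K \<le> 2 * min m (min p q) + K" "t \<le> 80 * ((m + 1) * (K + 1))"
proof -
  let ?Q = "\<lambda>n s. result s \<and> (\<exists>K. K * K \<le> 2 * min m (min p q) + K \<and> n \<le> 80 * ((m + 1) * (K + 1)))"
  have "wp partition_prog ?Q 0 (input_state p q es)"
    unfolding partition_prog_def wp_Seq[of level_bound_prog] wp_Seq[of adjacency_prog]
      wp_Seq[of auction_prog] wp_Seq[of "Assign 13 (Const 1)"]
  proof (rule wp_level_bound)
    fix n1 s1
    assume 1: "n1 \<le> 0 + 6 * m + 2" "input_ok s1" "fresh s1" "arr s1 4 = (\<lambda>_. 0)"
    define K where "K = reg s1 4"
    assume "min m (min p q) \<le> reg s1 4 * reg s1 4" "reg s1 4 * reg s1 4 \<le> 2 * min m (min p q) + reg s1 4"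
    then have K: "min m (min p q) \<le> K * K" "K * K \<le> 2 * min m (min p q) + K"
      by (simp_all only: K_def)
    show "wp adjacency_prog (wp auction_prog (wp (Assign 13 (Const 1))
      (wp (While (Less (Const 0) (Reg 13)) (search_init_prog ;; search_prog ;; augment_prog)) ?Q))) n1 s1"
    proof (rule wp_adjacency[OF 1(2-4) K_def[symmetric]], rule wp_auction, assumption+)
      fix n2 s2 n3 s3
      assume 2: "n2 \<le> n1 + 4 * m + 2"
        and 3: "n3 \<le> n2 + 24 * (m * K) + 24 * m + 2" "input_ok s3" "adjacency (arr s3 4) (arr s3 5)"
          "\<forall>a\<in>{2, 3, 10}. arr s3 a = (\<lambda>_. 0)" "mates (arr s3 6)"
          "\<And>h. mates h \<Longrightarrow> K * num_mates h \<le> K * num_mates (arr s3 6) + num_mates (arr s3 6)"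
      have "num_mates h \<le> num_mates (arr s3 6) + K" if h: "mates h" for h
      proof (cases "K = 0")
        case True
        then show ?thesis
          using K(1) num_mates_le_m[OF h] num_mates_le_p[OF h] num_mates_le_q[OF h] by auto
      next
        case False
        \<comment> \<open>The auction leaves a deficit of at most
          \<open>num_mates (arr s3 6) / K\<close>; since the matching has at most
          \<open>K * K\<close> edges, this is at most \<open>K\<close>.\<close>
        have "num_mates (arr s3 6) \<le> min m (min p q)"
          using num_mates_le_m num_mates_le_p num_mates_le_q 3(5) by simp
        also note K(1)
        finally have "K * num_mates h \<le> K * (num_mates (arr s3 6) + K)"
          using 3(6)[OF h] by (simp add: distrib_left)
        then show ?thesis
          using False by simp
      qed
      then show "wp (Assign 13 (Const 1))
        (wp (While (Less (Const 0) (Reg 13)) (search_init_prog ;; search_prog ;; augment_prog)) ?Q) n3 s3"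
        unfolding wp_Assign
      proof (intro wp_phases[OF 3(5)])
        fix n4 s4 assume 4: "n4 \<le> Suc n3 + (40 * m + 20) * Suc K + 1" "result s4"
        have "n4 \<le> 80 * ((m + 1) * (K + 1))"
          using 1(1) 2 3(1) 4(1) by (simp add: algebra_simps)
        then show "?Q n4 s4"
          using 4(2) K(2) by blast
      qed (use 3 in \<open>simp_all add: graph_ok_def input_ok_def supported_def\<close>)
    qed
  qed (auto simp: input_state_def input_ok_def fresh_def)
  then show thesis
    using that by (auto simp: wp_def)
qed

end

text \<open>The constant is \<open>80 * 2 * 4\<close>, from \<open>m + 1 \<le> 2 * m\<close> and
  \<open>K + 1 \<le> 4 * ?r\<close> if there are edges. Without edges the time is at most 160, which
  the summand 1 covers.\<close>

lemma partition_prog_time: "computes_partitions_in_time partition_prog 640"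
  unfolding computes_partitions_in_time_def
proof (intro allI impI)
  fix p q :: nat and es :: "(nat \<times> nat) list"
  assume es: "distinct es \<and> set es \<subseteq> {..<p} \<times> {..<q}"
  then interpret edge_list p q es
    by unfold_locales simp
  obtain t s K where exec: "exec partition_prog (input_state p q es) t s" "result s"
    and K: "K * K \<le> 2 * min m (min p q) + K" and t: "t \<le> 80 * ((m + 1) * (K + 1))"
    by (rule exec_partition_prog)
  let ?r = "sqrt (real (min p q))"
  have "real t \<le> 640 * (1 + real m * ?r)"
  proof (cases "m = 0")
    case True
    then have "K * K \<le> K"
      using K by simp
    then have "K \<le> 1"
      by (cases K) auto
    then have "t \<le> 160"
      using t True by simp
    then show ?thesis
      using True by simp
  next
    case False
    then have "es ! 0 \<in> {..<p} \<times> {..<q}"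
      using es by (metis length_greater_0_conv nth_mem subsetD length_0_conv)
    then have pq: "1 \<le> real (min p q)"
      by auto
    have r: "1 \<le> ?r" "real (min p q) = ?r * ?r"
      using pq by simp_all
    \<comment> \<open>Completing the square turns the quadratic bound on \<open>K\<close> into
      \<open>K - 1 \<le> 2 * ?r\<close>, using \<open>?r \<ge> 1\<close> to absorb the
      constant.\<close>
    have "(real K - 1) * (real K - 1) = real (K * K) - 2 * real K + 1"
      by (simp add: algebra_simps)
    moreover have "real (K * K) \<le> real (2 * min p q + K)"
      using K by (intro of_nat_mono) linarith
    ultimately have "(real K - 1) * (real K - 1) \<le> 2 * (?r * ?r) + 1"
      using r(2) by simp
    also have "\<dots> \<le> (2 * ?r) * (2 * ?r)"
      using mult_mono[OF r(1) r(1)] r(1) by linarith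
    finally have "(real K - 1)\<^sup>2 \<le> (2 * ?r)\<^sup>2"
      by (simp only: power2_eq_square)
    then have "real K - 1 \<le> 2 * ?r"
      by (rule power2_le_imp_le) (use r(1) in linarith)
    then have "real (K + 1) \<le> 4 * ?r"
      using r(1) unfolding of_nat_add of_nat_1 by linarith
    moreover have "real (m + 1) \<le> real (2 * m)"
      using False by (intro of_nat_mono) linarith
    ultimately have "real (m + 1) * real (K + 1) \<le> real (2 * m) * (4 * ?r)"
      by (intro mult_mono) auto
    moreover have "real t \<le> 80 * (real (m + 1) * real (K + 1))"
      using of_nat_mono[OF t, where 'a = real] by (simp only: of_nat_mult of_nat_numeral)
    ultimately show ?thesis
      by simp
  qed
  then show "\<exists>t s XS XL YS YL. exec partition_prog (input_state p q es) t s \<and>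
      real t \<le> 640 * (1 + real (length es) * sqrt (real (min p q))) \<and>
      output_partition p q s = (XS, XL, YS, YL) \<and>
      envy_free_partition {..<p} {..<q} (set es) XS XL YS YL"
    using exec unfolding result_def output_partition_def by blast
qed

theorem theorem1p3:
  "(\<forall>(X :: 'a set) (Y :: 'b set) E. bipartite_graph X Y E \<longrightarrow>
      (\<exists>!(XS, XL, YS, YL). envy_free_partition X Y E XS XL YS YL) \<and>
      (\<forall>XS XL YS YL. envy_free_partition X Y E XS XL YS YL \<longrightarrow>
         (\<exists>M. saturating_matching XL (induced E XL YL) M) \<and>
         (\<forall>M. saturating_matching XL (induced E XL YL) M \<longrightarrow> envy_free_matching X E M) \<and>
         (\<forall>M. envy_free_matching X E M \<longrightarrow> M \<subseteq> induced E XL YL))) \<and>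
   (\<exists>prog C. computes_partitions_in_time prog C)"
  using envy_free_partition_properties partition_prog_time by blast

end
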